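(* Let $\{\mu^\theta:\theta\ge0\}$ be an infinitely divisible (convolution) semigroup of probability distributions on the nonnegative integers $\mathbb{N}_0=\{0,1,2,\dots\}$ with $\mu^\theta(\{1\})>0$ for $\theta>0$. Fix $\theta>0$ and $0<\rho<1$, put $\lambda=-\log\rho$, and let $\{X_t\}_{t\in\mathbb{Z}}$ be the random measure process $X_t:=\mathcal{N}(G_t)$, where $\mathcal{N}$ is the random measure on $\mathbb{R}^2$ determined by $\{\mu^\theta\}$ (defined in the context) and $$G_t:=\left\{(x,y):\ x\in\mathbb{R},\ 0\le y<\theta\lambda\,e^{-2\lambda|t-x|}\right\}.$$ Then $X_t$ is infinitely divisible (all its finite-dimensional marginal distributions are infinitely divisible), stationary, time-reversible, and nonnegative integer valued, but it is not a Markov process unless $\{\mu^\theta\}$ is the Poisson family.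
   Context: Convolution semigroup: $\mu^{\theta_1}*\mu^{\theta_2}=\mu^{\theta_1+\theta_2}$ for all $\theta_1,\theta_2\ge0$ and $\mu^0=\delta_0$. "$\{\mu^\theta\}$ is the Poisson family" means that for some constant $c>0$, $\mu^\theta$ is the Poisson distribution with mean $c\theta$ for every $\theta\ge 0$. $\mathcal{N}(dx\,dy)$ is a countably additive random measure on $\mathbb{R}^2$ that assigns independent random variables $\mathcal{N}(A_i)\sim\mu^{|A_i|}$ to disjoint Borel sets $A_i\subset\mathbb{R}^2$ of finite area (Lebesgue measure) $|A_i|$. The sets $G_t$ satisfy $|G_s\cap G_t|=\theta e^{-\lambda|s-t|}=\theta\rho^{|s-t|}$. For a finite set $T\subset\mathbb{Z}$ let $\mu_T$ be the joint distribution of $X_T=(X_t)_{t\in T}$. The process is stationary if $\mu_T=\mu_{s+T}$ for all finite $T\subset\mathbb{Z}$ and $s\in\mathbb{Z}$; time-reversible if it is stationary and also $\mu_T=\mu_{-T}$ for all finite $T$, where $-T=\{-t:t\in T\}$ (coordinates matched by $t\leftrightarrow-t$); Markov if for every $t\in\mathbb{Z}$, every finite $T\subset\{s\in\mathbb{Z}:s\ge t\}$ and every Borel $B\subset\mathbb{R}^{|T|}$, $\mathsf{P}[X_T\in B\mid\mathcal{F}_t]=\mathsf{P}[X_T\in B\mid X_t]$, where $\mathcal{F}_t=\sigma\{X_s:s\le t\}$. It is infinitely divisible if for every finite $T\subset\mathbb{Z}$ there is a finite measure $\nu_T$ on $\mathbb{Z}^{|T|}$ with $\int e^{i\omega'x}\mu_T(dx)=\exp\{\int_{\mathbb{Z}^{|T|}}(e^{i\omega'u}-1)\,\nu_T(du)\}$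 for all $\omega\in\mathbb{R}^{|T|}$ (equivalently, for each $n\ge1$, $\mu_T$ is the $n$-fold convolution of some probability distribution on $\mathbb{N}_0^{|T|}$). *)

theory Defs
  imports "HOL-Probability.Probability"
begin

definition convolution_semigroup :: "(real \<Rightarrow> nat pmf) \<Rightarrow> bool" where
  "convolution_semigroup \<mu> \<longleftrightarrow>
     \<mu> 0 = return_pmf 0 \<and>
     (\<forall>a\<ge>0. \<forall>b\<ge>0. map_pmf (\<lambda>(x, y). x + y) (pair_pmf (\<mu> a) (\<mu> b)) = \<mu> (a + b))"

(* poisson_pmf is only specified for positive rates; the Poisson distribution with mean 0
   is the point mass at 0. *)
definition poisson_family :: "(real \<Rightarrow> nat pmf) \<Rightarrow> bool" where
  "poisson_family \<mu> \<longleftrightarrow>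
     (\<exists>c>0. \<forall>\<theta>\<ge>0. \<mu> \<theta> = (if \<theta> = 0 then return_pmf 0 else poisson_pmf (c * \<theta>)))"

(* Countable additivity is built into the type of N. Independence is required for sequences of
   disjoint sets; finite families are covered by filling up with empty sets. Nothing is required
   of sets of infinite area, where the value may be infinite. *)
definition independent_random_measure ::
    "'w measure \<Rightarrow> (real \<Rightarrow> nat pmf) \<Rightarrow> ('w \<Rightarrow> (real \<times> real) measure) \<Rightarrow> bool" where
  "independent_random_measure M \<mu> N \<longleftrightarrow>
     (\<forall>\<omega>\<in>space M. sets (N \<omega>) = sets borel) \<and>
     (\<forall>A\<in>sets borel. (\<lambda>\<omega>. emeasure (N \<omega>) A) \<in> borel_measurable M) \<and>
     (\<forall>A\<in>sets borel. emeasure lborel A < \<infinity> \<longrightarrow>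
        distr M borel (\<lambda>\<omega>. emeasure (N \<omega>) A) =
        distr (measure_pmf (\<mu> (measure lborel A))) borel (\<lambda>n. of_nat n :: ennreal)) \<and>
     (\<forall>A :: nat \<Rightarrow> (real \<times> real) set.
        disjoint_family A \<and> (\<forall>i. A i \<in> sets borel \<and> emeasure lborel (A i) < \<infinity>) \<longrightarrow>
        prob_space.indep_vars M (\<lambda>_. borel) (\<lambda>i \<omega>. emeasure (N \<omega>) (A i)) UNIV)"

definition G :: "real \<Rightarrow> real \<Rightarrow> int \<Rightarrow> (real \<times> real) set" where
  "G \<theta> l t = {(x, y). 0 \<le> y \<and> y < \<theta> * l * exp (- 2 * l * \<bar>of_int t - x\<bar>)}"

(* The value emeasure (N \<omega>) (G \<theta> l t) is almost surely finite, since G \<theta> l t has finite area. *)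
definition random_measure_process ::
    "('w \<Rightarrow> (real \<times> real) measure) \<Rightarrow> real \<Rightarrow> real \<Rightarrow> int \<Rightarrow> 'w \<Rightarrow> real" where
  "random_measure_process N \<theta> l t \<omega> = measure (N \<omega>) (G \<theta> l t)"

definition fdd :: "'w measure \<Rightarrow> (int \<Rightarrow> 'w \<Rightarrow> real) \<Rightarrow> int set \<Rightarrow> (int \<Rightarrow> real) measure" where
  "fdd M X T = distr M (Pi\<^sub>M T (\<lambda>_. borel)) (\<lambda>\<omega>. \<lambda>t\<in>T. X t \<omega>)"

definition nonneg_integer_valued :: "'w measure \<Rightarrow> (int \<Rightarrow> 'w \<Rightarrow> real) \<Rightarrow> bool" where
  "nonneg_integer_valued M X \<longleftrightarrow>
     (\<forall>t. X t \<in> borel_measurable M \<and> (AE \<omega> in M. X t \<omega> \<in> \<nat>))"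

definition infinitely_divisible_process :: "'w measure \<Rightarrow> (int \<Rightarrow> 'w \<Rightarrow> real) \<Rightarrow> bool" where
  "infinitely_divisible_process M X \<longleftrightarrow>
     (\<forall>T. finite T \<longrightarrow>
        (\<exists>\<nu> :: (int \<Rightarrow> int) measure.
           sets \<nu> = sets (Pi\<^sub>M T (\<lambda>_. count_space UNIV)) \<and> finite_measure \<nu> \<and>
           (\<forall>w :: int \<Rightarrow> real.
              (CLINT x | fdd M X T. iexp (\<Sum>t\<in>T. w t * x t)) =
              exp (CLINT u | \<nu>. (iexp (\<Sum>t\<in>T. w t * of_int (u t)) - 1)))))"

(* fdd M (\<lambda>t. X (s + t)) T is the joint distribution of the process on the shifted index set
   s + T, with its coordinates indexed by T via t \<leftrightarrow> s + t; likewise below with -T. *)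
definition stationary_process :: "'w measure \<Rightarrow> (int \<Rightarrow> 'w \<Rightarrow> real) \<Rightarrow> bool" where
  "stationary_process M X \<longleftrightarrow>
     (\<forall>T s. finite T \<longrightarrow> fdd M X T = fdd M (\<lambda>t. X (s + t)) T)"

definition time_reversible_process :: "'w measure \<Rightarrow> (int \<Rightarrow> 'w \<Rightarrow> real) \<Rightarrow> bool" where
  "time_reversible_process M X \<longleftrightarrow>
     stationary_process M X \<and> (\<forall>T. finite T \<longrightarrow> fdd M X T = fdd M (\<lambda>t. X (- t)) T)"

definition generated_sigma ::
    "'w measure \<Rightarrow> (int \<Rightarrow> 'w \<Rightarrow> real) \<Rightarrow> int set \<Rightarrow> 'w measure" where
  "generated_sigma M X S =
     sigma (space M) (\<Union>s\<in>S. {X s -` B \<inter> space M | B. B \<in> sets borel})"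

definition markov_process :: "'w measure \<Rightarrow> (int \<Rightarrow> 'w \<Rightarrow> real) \<Rightarrow> bool" where
  "markov_process M X \<longleftrightarrow>
     (\<forall>t T B. finite T \<and> T \<subseteq> {t..} \<and> B \<in> sets (Pi\<^sub>M T (\<lambda>_. borel)) \<longrightarrow>
        (let E = {\<omega>\<in>space M. (\<lambda>s\<in>T. X s \<omega>) \<in> B} in
         AE \<omega> in M. real_cond_exp M (generated_sigma M X {..t}) (indicator E) \<omega> =
                    real_cond_exp M (generated_sigma M X {t}) (indicator E) \<omega>))"

end

theory Submission
  imports Defs
begin

text \<open>Write \<open>f a\<close> for the generating function of \<open>\<mu> a\<close>. The logarithmic derivative \<open>f' / f\<close> is additive
  in \<open>a\<close> and has nonnegative coefficients, hence is linear in \<open>a\<close>; integrating it shows that \<open>\<mu> a\<close> is compound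
  Poisson with Levy weights \<open>a * levy k\<close>. A finite family of sets \<open>H t\<close> splits the plane into disjoint atoms, so
  the joint law of the values \<open>N (H t)\<close> depends only on the areas of the atoms, and its characteristic
  function is a product of compound Poisson ones. Stationarity and reversibility follow since translations
  and reflections of the plane preserve area.

  If the process is Markov, then \<open>X (-1) = 0\<close> and \<open>X 1 = 0\<close> are independent given \<open>X 0 = n\<close>. The area of
  \<open>G 0 - (G (-1) \<union> G 1)\<close> is \<open>\<theta> * r\<^sup>2\<close> and those of \<open>G 0 - G (-1)\<close> and \<open>G 0 - G 1\<close> are \<open>\<theta> * r\<close>, where
  \<open>r = 1 - \<rho>\<close>, because \<open>G (-1) \<inter> G 1 \<subseteq> G 0\<close>. With \<open>h a n = \<mu> a {n} / \<mu> a {0}\<close> this gives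
  \<open>h (\<theta> * r\<^sup>2) n * h \<theta> n = (h (\<theta> * r) n)\<^sup>2\<close>. If \<open>levy\<close> vanishes at \<open>2, \<dots>, n - 1\<close>, then
  \<open>h a n = (levy 1 * a)^n / n! + a * levy n\<close>, and the identity reduces to \<open>levy n * (r^n - r)\<^sup>2 = 0\<close>.\<close>

section \<open>Convolution semigroups on the natural numbers\<close>

text \<open>Cauchy's functional equation on the half-line: nonnegativity makes \<open>h\<close>
  monotone, and squeezing \<open>real n * a\<close> between consecutive integers leaves an error of
  at most \<open>h 1\<close>, which does not grow with \<open>n\<close>.\<close>

lemma additive_nonneg_linear:
  fixes h :: "real \<Rightarrow> real"
  assumes add: "\<And>a b. a \<ge> 0 \<Longrightarrow> b \<ge> 0 \<Longrightarrow> h (a + b) = h a + h b"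
    and nonneg: "\<And>a. a \<ge> 0 \<Longrightarrow> h a \<ge> 0" and a: "a \<ge> 0"
  shows "h a = a * h 1"
proof -
  have mult: "h (real n * b) = real n * h b" if "b \<ge> 0" for n b
  proof (induction n)
    case 0
    show ?case using add[of 0 0] by simp
  next
    case (Suc n)
    have "h (real (Suc n) * b) = h (b + real n * b)" by (simp add: algebra_simps)
    also have "\<dots> = h b + h (real n * b)" using that by (intro add) auto
    finally show ?case using Suc by (simp add: algebra_simps)
  qed
  have mono: "h b \<le> h c" if "0 \<le> b" "b \<le> c" for b c
    using add[of b "c - b"] nonneg[of "c - b"] that by simp
  have bound: "real n * \<bar>h a - a * h 1\<bar> \<le> h 1" for n
  proof -
    define m where "m = nat \<lfloor>real n * a\<rfloor>"
    have m: "real m \<le> real n * a" "real n * a \<le> real m + 1"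
      unfolding m_def using a by (auto simp: of_nat_nat)
    have "real m * h 1 \<le> real n * h a"
      using mono[of "real m" "real n * a"] m mult[of 1 m] mult[of a n] a by simp
    moreover have "real n * h a \<le> (real m + 1) * h 1"
      using mono[of "real n * a" "real (Suc m)"] m mult[of 1 "Suc m"] mult[of a n] a
      by (simp add: algebra_simps)
    moreover have "real m * h 1 \<le> real n * a * h 1" "real n * a * h 1 \<le> (real m + 1) * h 1"
      using m nonneg[of 1] by (auto intro!: mult_right_mono)
    ultimately have "\<bar>real n * h a - real n * a * h 1\<bar> \<le> h 1"
      by (simp add: algebra_simps abs_le_iff)
    moreover have "real n * h a - real n * a * h 1 = real n * (h a - a * h 1)"
      by (simp add: right_diff_distrib)
    ultimately show ?thesis by (simp add: abs_mult)
  qed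
  show ?thesis
  proof (rule ccontr)
    assume "h a \<noteq> a * h 1"
    then have "\<bar>h a - a * h 1\<bar> > 0" by simp
    from ex_less_of_nat_mult[OF this, of "h 1"] bound show False by (meson not_le)
  qed
qed

lemma pmf_sum_convolution:
  fixes p q :: "nat pmf"
  shows "pmf (map_pmf (\<lambda>(x, y). x + y) (pair_pmf p q)) n = (\<Sum>i\<le>n. pmf p i * pmf q (n - i))"
proof -
  have vim: "(\<lambda>(x, y). x + y) -` {n} = (\<lambda>i. (i, n - i)) ` {..n}" by (auto simp: image_iff)
  have "pmf (map_pmf (\<lambda>(x, y). x + y) (pair_pmf p q)) n =
      sum (pmf (pair_pmf p q)) ((\<lambda>i. (i, n - i)) ` {..n})"
    by (subst pmf_map, subst vim, rule measure_measure_pmf_finite) simp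
  also have "\<dots> = (\<Sum>i\<le>n. pmf p i * pmf q (n - i))"
    by (subst sum.reindex) (auto simp: inj_on_def pmf_pair)
  finally show ?thesis .
qed

lemma pmf_nat_sums: "pmf (p :: nat pmf) sums 1"
  using infsetsum_nat'[of "pmf p"] abs_summable_on_nat_iff'[of "pmf p"] pmf_abs_summable[of p UNIV]
    infsetsum_pmf_eq_1[of p UNIV]
  by (simp add: sums_iff)

locale nat_convolution_semigroup =
  fixes \<mu> :: "real \<Rightarrow> nat pmf"
  assumes semigroup: "convolution_semigroup \<mu>"
    and one_pos: "a > 0 \<Longrightarrow> 0 < measure_pmf.prob (\<mu> a) {1}"
begin

lemma pmf_at_zero: "\<mu> 0 = return_pmf 0"
  using semigroup by (simp add: convolution_semigroup_def)

lemma pmf_add: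
  assumes "a \<ge> 0" "b \<ge> 0"
  shows "pmf (\<mu> (a + b)) n = (\<Sum>i\<le>n. pmf (\<mu> a) i * pmf (\<mu> b) (n - i))"
  using semigroup assms pmf_sum_convolution[of "\<mu> a" "\<mu> b" n]
  by (simp add: convolution_semigroup_def)

lemma pmf_one_pos: "a > 0 \<Longrightarrow> 0 < pmf (\<mu> a) 1"
  using one_pos[of a] by (simp add: pmf.rep_eq)

text \<open>Halving \<open>a\<close> writes \<open>pmf (\<mu> a) 1\<close> as twice the product of
  the masses of \<open>\<mu> (a/2)\<close> at 0 and 1. The assumed mass at 1 thus forces mass at 0
  for \<open>a/2\<close>, and squaring passes it on to \<open>a\<close>.\<close>

lemma pmf_zero_pos:
  assumes "a \<ge> 0"
  shows "0 < pmf (\<mu> a) 0"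
proof (cases "a = 0")
  case False
  then have "a > 0" using assms by simp
  have "pmf (\<mu> (a/2 + a/2)) 1 = (\<Sum>i\<le>1. pmf (\<mu> (a/2)) i * pmf (\<mu> (a/2)) (1 - i))"
    by (intro pmf_add) (use assms in auto)
  then have "pmf (\<mu> a) 1 = 2 * pmf (\<mu> (a/2)) 0 * pmf (\<mu> (a/2)) 1" by (simp add: atMost_Suc)
  with pmf_one_pos[OF \<open>a > 0\<close>] have "pmf (\<mu> (a/2)) 0 \<noteq> 0" by auto
  moreover have "pmf (\<mu> (a/2 + a/2)) 0 = (\<Sum>i\<le>0. pmf (\<mu> (a/2)) i * pmf (\<mu> (a/2)) (0 - i))"
    by (intro pmf_add) (use assms in auto)
  ultimately have "pmf (\<mu> a) 0 \<noteq> 0" by simp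
  then show ?thesis by (simp add: less_le)
qed (simp add: pmf_at_zero)

section \<open>Formal generating functions and their logarithmic derivatives\<close>

definition pgf :: "real \<Rightarrow> real fps" where
  "pgf a = Abs_fps (pmf (\<mu> a))"

lemma pgf_nth [simp]: "fps_nth (pgf a) n = pmf (\<mu> a) n"
  by (simp add: pgf_def)

lemma pgf_add: "a \<ge> 0 \<Longrightarrow> b \<ge> 0 \<Longrightarrow> pgf (a + b) = pgf a * pgf b"
  by (simp add: fps_eq_iff fps_mult_nth pmf_add atLeast0AtMost)

lemma pgf_power: "a \<ge> 0 \<Longrightarrow> pgf (real n * a) = pgf a ^ n"
proof (induction n)
  case 0
  show ?case by (auto simp: fps_eq_iff pmf_at_zero)
next
  case (Suc n)
  have "pgf (real (Suc n) * a) = pgf (a + real n * a)" by (simp add: algebra_simps)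
  then show ?case using Suc by (simp add: pgf_add)
qed

lemma pgf_nonzero: "a \<ge> 0 \<Longrightarrow> pgf a \<noteq> 0"
  using pmf_zero_pos[of a] by (auto simp: fps_eq_iff intro!: exI[of _ 0])

text \<open>For \<open>a \<ge> 0\<close> the constant coefficient of \<open>pgf a\<close> is
  positive by \<open>pmf_zero_pos\<close>, so \<open>inverse\<close> is a true inverse there. Formal
  series keep questions of convergence out of this stage.\<close>

definition logderiv :: "real \<Rightarrow> real fps" where
  "logderiv a = fps_deriv (pgf a) * inverse (pgf a)"

lemma logderiv_mult_pgf: "a \<ge> 0 \<Longrightarrow> logderiv a * pgf a = fps_deriv (pgf a)"
  using pmf_zero_pos[of a] unfolding logderiv_def
  by (simp add: mult.assoc inverse_mult_eq_1)

lemma logderiv_add: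
  assumes "a \<ge> 0" "b \<ge> 0"
  shows "logderiv (a + b) = logderiv a + logderiv b"
proof -
  have "logderiv (a + b) * pgf (a + b) = fps_deriv (pgf a * pgf b)"
    using assms logderiv_mult_pgf[of "a + b"] pgf_add[of a b] by simp
  also have "\<dots> = (logderiv a * pgf a) * pgf b + pgf a * (logderiv b * pgf b)"
    using assms by (simp add: logderiv_mult_pgf)
  also have "\<dots> = (logderiv a + logderiv b) * pgf (a + b)"
    using assms by (simp add: pgf_add algebra_simps)
  finally show ?thesis using pgf_nonzero[of "a + b"] assms by simp
qed

text \<open>Since \<open>pgf a\<close> is the \<open>Suc n\<close>-th power of
  \<open>pgf (a / real (Suc n))\<close>, the mass at 0 is a root of a fixed positive number and
  tends to 1; every other mass is at most what remains.\<close>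

lemma pmf_divide_tendsto:
  assumes a: "a \<ge> 0"
  shows "(\<lambda>n. pmf (\<mu> (a / real (Suc n))) k) \<longlonglongrightarrow> (if k = 0 then 1 else 0)"
proof -
  have root: "pmf (\<mu> (a / real (Suc n))) 0 = root (Suc n) (pmf (\<mu> a) 0)" for n
  proof -
    have "pgf a = pgf (a / real (Suc n)) ^ Suc n"
      using pgf_power[of "a / real (Suc n)" "Suc n"] a by simp
    then have "pmf (\<mu> a) 0 = pmf (\<mu> (a / real (Suc n))) 0 ^ Suc n"
      by (metis fps_power_zeroth pgf_nth)
    then show ?thesis
      by (simp only: real_root_power_cancel[OF zero_less_Suc pmf_nonneg])
  qed
  have zero: "(\<lambda>n. pmf (\<mu> (a / real (Suc n))) 0) \<longlonglongrightarrow> 1"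
    unfolding root using LIMSEQ_root_const[OF pmf_zero_pos[OF a]] by (rule LIMSEQ_Suc)
  show ?thesis
  proof (cases "k = 0")
    case False
    have le: "pmf (\<mu> b) k \<le> 1 - pmf (\<mu> b) 0" for b
      using sum_le_suminf[of "pmf (\<mu> b)" "{0, k}"] pmf_nat_sums[of "\<mu> b"] False
      by (simp add: sums_iff)
    have "(\<lambda>n. 1 - pmf (\<mu> (a / real (Suc n))) 0) \<longlonglongrightarrow> 1 - 1"
      by (intro tendsto_intros zero)
    then have lim: "(\<lambda>n. 1 - pmf (\<mu> (a / real (Suc n))) 0) \<longlonglongrightarrow> 0" by simp
    have "(\<lambda>n. pmf (\<mu> (a / real (Suc n))) k) \<longlonglongrightarrow> 0"
      by (rule tendsto_sandwich[OF _ _ tendsto_const lim]) (use le in simp_all)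
    then show ?thesis using False by simp
  qed (use zero in simp)
qed

text \<open>With \<open>\<epsilon> = a / n\<close>, the product \<open>logderiv a * pgf \<epsilon> = n * fps_deriv (pgf \<epsilon>)\<close> has
  nonnegative coefficients, and \<open>pgf \<epsilon>\<close> tends to \<open>1\<close>.\<close>

lemma logderiv_nonneg:
  assumes a: "a \<ge> 0"
  shows "0 \<le> fps_nth (logderiv a) k"
proof -
  define \<epsilon> where "\<epsilon> n = a / real (Suc n)" for n
  have \<epsilon>: "\<epsilon> n \<ge> 0" "a = real (Suc n) * \<epsilon> n" for n using a by (auto simp: \<epsilon>_def)
  have mult: "logderiv (real m * b) = of_nat m * logderiv b" if "b \<ge> 0" for m b
  proof (induction m)
    case 0
    show ?case using logderiv_add[of 0 0] by simp
  next
    case (Suc m)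
    have "logderiv (real (Suc m) * b) = logderiv (b + real m * b)" by (simp add: algebra_simps)
    then show ?case using Suc that by (simp add: logderiv_add algebra_simps)
  qed
  have "logderiv a * pgf (\<epsilon> n) = of_nat (Suc n) * fps_deriv (pgf (\<epsilon> n))" for n
    using mult[OF \<epsilon>(1), of "Suc n"] \<epsilon>(2)[of n] logderiv_mult_pgf[OF \<epsilon>(1), of n]
    by (simp add: mult.assoc)
  then have pos: "0 \<le> fps_nth (logderiv a * pgf (\<epsilon> n)) k" for n
    by (simp add: fps_of_nat[symmetric])
  have "(\<lambda>n. fps_nth (logderiv a * pgf (\<epsilon> n)) k) \<longlonglongrightarrow> fps_nth (logderiv a) k"
  proof -
    have "(\<lambda>n. fps_nth (logderiv a * pgf (\<epsilon> n)) k) \<longlonglongrightarrow>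
        (\<Sum>i=0..k. fps_nth (logderiv a) i * (if k - i = 0 then 1 else 0))"
      unfolding fps_mult_nth pgf_nth \<epsilon>_def by (intro tendsto_intros pmf_divide_tendsto a)
    also have "(\<Sum>i=0..k. fps_nth (logderiv a) i * (if k - i = 0 then 1 else 0)) =
        (\<Sum>i\<in>{k}. fps_nth (logderiv a) i)"
      by (rule sum.mono_neutral_cong_right) auto
    finally show ?thesis by simp
  qed
  then show ?thesis by (rule LIMSEQ_le_const) (use pos in blast)
qed

lemma logderiv_linear: "a \<ge> 0 \<Longrightarrow> fps_nth (logderiv a) k = a * fps_nth (logderiv 1) k"
proof (rule additive_nonneg_linear[of "\<lambda>a. fps_nth (logderiv a) k"])
  show "fps_nth (logderiv (b + c)) k = fps_nth (logderiv b) k + fps_nth (logderiv c) k"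
    if "0 \<le> b" "0 \<le> c" for b c
    unfolding logderiv_add[OF that] by (rule fps_add_nth)
  show "0 \<le> fps_nth (logderiv b) k" if "0 \<le> b" for b
    by (rule logderiv_nonneg[OF that])
qed

text \<open>For \<open>k > 0\<close> this is the coefficient of \<open>z ^ k\<close> in the
  logarithm of the generating function of \<open>\<mu> 1\<close>; differentiation shifts the index
  by one and brings in the factor \<open>k\<close>. In the compound Poisson picture it is the rate
  of jumps of size \<open>k\<close>.\<close>

definition levy :: "nat \<Rightarrow> real" where
  "levy k = (if k = 0 then 0 else fps_nth (logderiv 1) (k - 1) / real k)"

lemma levy_nonneg: "0 \<le> levy k"
  by (simp add: levy_def logderiv_nonneg)

lemma levy_zero [simp]: "levy 0 = 0"
  by (simp add: levy_def)

text \<open>Comparing coefficients in \<open>f' = (log f)' f\<close> gives the Panjer recursion of a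
  compound Poisson law.\<close>

lemma pmf_recursion:
  assumes "a \<ge> 0"
  shows "real (Suc n) * pmf (\<mu> a) (Suc n) =
    a * (\<Sum>i\<le>n. real (Suc i) * levy (Suc i) * pmf (\<mu> a) (n - i))"
proof -
  have "real (Suc n) * pmf (\<mu> a) (Suc n) = fps_nth (logderiv a * pgf a) n"
    using assms by (simp add: logderiv_mult_pgf)
  also have "\<dots> = (\<Sum>i\<le>n. fps_nth (logderiv a) i * pmf (\<mu> a) (n - i))"
    by (simp add: fps_mult_nth atLeast0AtMost)
  also have "\<dots> = (\<Sum>i\<le>n. a * (real (Suc i) * levy (Suc i) * pmf (\<mu> a) (n - i)))"
  proof (rule sum.cong[OF refl])
    fix i
    have "fps_nth (logderiv a) i = a * (real (Suc i) * levy (Suc i))"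
      unfolding levy_def logderiv_linear[OF assms, of i] by (simp del: of_nat_Suc)
    then show "fps_nth (logderiv a) i * pmf (\<mu> a) (n - i) =
        a * (real (Suc i) * levy (Suc i) * pmf (\<mu> a) (n - i))" by simp
  qed
  finally show ?thesis by (simp add: sum_distrib_left)
qed

text \<open>Keeping only the term \<open>i = n\<close> of the recursion bounds
  \<open>levy (Suc n)\<close> by a constant multiple of the mass of \<open>\<mu> 1\<close> at
  \<open>Suc n\<close>.\<close>

lemma summable_levy: "summable levy"
proof -
  have "norm (levy (Suc n)) \<le> pmf (\<mu> 1) (Suc n) / pmf (\<mu> 1) 0" for n
  proof -
    have "(\<Sum>i\<in>{n}. real (Suc i) * levy (Suc i) * pmf (\<mu> 1) (n - i)) \<le>
        (\<Sum>i\<le>n. real (Suc i) * levy (Suc i) * pmf (\<mu> 1) (n - i))"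
      by (rule sum_mono2) (auto intro!: mult_nonneg_nonneg levy_nonneg)
    then have "real (Suc n) * (levy (Suc n) * pmf (\<mu> 1) 0) \<le> real (Suc n) * pmf (\<mu> 1) (Suc n)"
      unfolding pmf_recursion[OF zero_le_one] by simp
    then have "levy (Suc n) * pmf (\<mu> 1) 0 \<le> pmf (\<mu> 1) (Suc n)"
      by (simp only: mult_le_cancel_left_pos of_nat_0_less_iff zero_less_Suc)
    then show ?thesis using pmf_zero_pos[of 1] levy_nonneg by (simp add: pos_le_divide_eq)
  qed
  moreover have "summable (\<lambda>n. pmf (\<mu> 1) (Suc n) / pmf (\<mu> 1) 0)"
    using sums_summable[OF pmf_nat_sums, of "\<mu> 1"]
    by (intro summable_divide) (simp add: summable_Suc_iff)
  ultimately have "summable (\<lambda>n. levy (Suc n))"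
    using summable_comparison_test'[of "\<lambda>n. pmf (\<mu> 1) (Suc n) / pmf (\<mu> 1) 0" 0 "\<lambda>n. levy (Suc n)"]
    by blast
  then show ?thesis by (simp only: summable_Suc_iff)
qed

end

section \<open>Generating functions on the closed unit disc, and characteristic functions\<close>

lemma continuous_on_power_series_cball:
  fixes c :: "nat \<Rightarrow> complex"
  assumes "summable (\<lambda>n. norm (c n))"
  shows "continuous_on (cball 0 1) (\<lambda>z. \<Sum>n. c n * z ^ n)"
proof (rule uniform_limit_theorem)
  have "norm (c n * z ^ n) \<le> norm (c n)" if "z \<in> cball 0 1" for n z
    using that by (simp add: norm_mult norm_power mult_left_le power_le_one)
  then show "uniform_limit (cball 0 1) (\<lambda>n z. \<Sum>i<n. c i * z ^ i) (\<lambda>z. \<Sum>n. c n * z ^ n) sequentially"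
    by (intro Weierstrass_m_test[OF _ assms])
  show "\<forall>\<^sub>F n in sequentially. continuous_on (cball 0 1) (\<lambda>z. \<Sum>i<n. c i * z ^ i)"
    by (intro always_eventually allI continuous_intros)
qed (rule sequentially_bot)

lemma conv_radius_ge_one:
  fixes c :: "nat \<Rightarrow> complex"
  assumes "summable (\<lambda>n. norm (c n))"
  shows "1 \<le> conv_radius c"
  using conv_radius_geI[of c 1] summable_norm_cancel[OF assms] by (simp add: one_ereal_def[symmetric])

context nat_convolution_semigroup
begin

text \<open>By the recursion, \<open>f\<close> and \<open>exp (a * h)\<close> solve the same linear
  differential equation, so their quotient \<open>g\<close> is constant on the open disc. Absolute
  convergence gives continuity up to the unit circle, where the characteristic functions
  live.\<close>

lemma generating_function:
  fixes z :: complex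
  assumes a: "a \<ge> 0" and z: "norm z \<le> 1"
  shows "(\<Sum>n. of_real (pmf (\<mu> a) n) * z ^ n) =
    exp (of_real a * (\<Sum>k. of_real (levy k) * (z ^ k - 1)))"
proof -
  define f where "f = Abs_fps (\<lambda>n. complex_of_real (pmf (\<mu> a) n))"
  define h where "h = Abs_fps (\<lambda>n. complex_of_real (levy n))"
  have f_sum: "summable (\<lambda>n. norm (fps_nth f n))" and h_sum: "summable (\<lambda>n. norm (fps_nth h n))"
    using sums_summable[OF pmf_nat_sums, of "\<mu> a"] summable_levy levy_nonneg
    by (auto simp: f_def h_def abs_of_nonneg)
  have f_rad: "1 \<le> fps_conv_radius f" and h_rad: "1 \<le> fps_conv_radius h"
    unfolding fps_conv_radius_def using f_sum h_sum by (intro conv_radius_ge_one; simp)+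
  have ode: "fps_deriv f = fps_const (of_real a) * (fps_deriv h * f)"
  proof (rule fps_ext)
    fix n
    have "fps_nth (fps_deriv f) n = of_real (real (Suc n) * pmf (\<mu> a) (Suc n))"
      by (simp add: f_def)
    also have "\<dots> = of_real a * (\<Sum>i\<le>n. fps_nth (fps_deriv h) i * fps_nth f (n - i))"
      unfolding pmf_recursion[OF a] by (simp add: f_def h_def)
    finally show "fps_nth (fps_deriv f) n = fps_nth (fps_const (of_real a) * (fps_deriv h * f)) n"
      unfolding fps_mult_left_const_nth by (simp only: fps_mult_nth atLeast0AtMost)
  qed
  define g where "g w = eval_fps f w * exp (- of_real a * eval_fps h w)" for w
  have "\<exists>c. \<forall>w\<in>ball 0 1. g w = c"
  proof (rule has_field_derivative_zero_constant)
    fix w :: complex assume "w \<in> ball 0 1"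
    then have lt: "ereal (norm w) < 1" by (simp add: one_ereal_def)
    have w: "ereal (norm w) < fps_conv_radius f" "ereal (norm w) < fps_conv_radius h"
        "ereal (norm w) < fps_conv_radius (fps_deriv h)"
      by (rule less_le_trans[OF lt f_rad], rule less_le_trans[OF lt h_rad],
          rule less_le_trans[OF lt order_trans[OF h_rad fps_conv_radius_deriv]])
    have w': "ereal (norm w) < fps_conv_radius (fps_deriv h * f)"
      by (rule less_le_trans[OF _ fps_conv_radius_mult]) (use w in simp)
    have "eval_fps (fps_deriv f) w = of_real a * (eval_fps (fps_deriv h) w * eval_fps f w)"
      unfolding ode using w w' by (simp add: eval_fps_mult)
    then show "(g has_field_derivative 0) (at w within ball 0 1)"
      unfolding g_def
      by (auto intro!: derivative_eq_intros has_field_derivative_eval_fps w simp: algebra_simps)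
  qed simp
  then obtain c where const: "g w = c" if "w \<in> ball 0 1" for w by blast
  have closure: "closure (ball 0 1) = cball (0 :: complex) 1" by simp
  have g_cont: "continuous_on (closure (ball 0 1)) g"
    unfolding closure g_def eval_fps_def
    by (intro continuous_intros continuous_on_power_series_cball f_sum h_sum)
  have "g w = g 0" if "w \<in> cball 0 1" for w
    using continuous_constant_on_closure[OF g_cont const, of w] that const[of 0] closure by simp
  moreover have "g 0 = pmf (\<mu> a) 0"
    by (simp add: g_def eval_fps_at_0 f_def h_def)
  ultimately have sol: "eval_fps f w = pmf (\<mu> a) 0 * exp (of_real a * eval_fps h w)"
    if "w \<in> cball 0 1" for w
    using that by (simp add: g_def exp_minus field_simps)
  \<comment> \<open>Total mass 1 fixes the constant of integration as
    \<open>exp (- a * h 1)\<close>, which is the source of the \<open>- 1\<close> in the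
    exponent.\<close>
  have "eval_fps f 1 = 1"
    using sums_of_real[OF pmf_nat_sums[of "\<mu> a"], where ?'a = complex]
    by (simp add: eval_fps_def f_def sums_iff)
  with sol[of 1] have "complex_of_real (pmf (\<mu> a) 0) = exp (- of_real a * eval_fps h 1)"
    by (simp add: exp_minus field_simps)
  with sol[of z] z have "eval_fps f z = exp (of_real a * (eval_fps h z - eval_fps h 1))"
    by (simp add: exp_add[symmetric] algebra_simps)
  also have "eval_fps h z - eval_fps h 1 = (\<Sum>k. of_real (levy k) * (z ^ k - 1))"
  proof -
    have "summable (\<lambda>k. fps_nth h k * w ^ k)" if "norm w \<le> 1" for w
      using that by (intro summable_norm_cancel[OF summable_comparison_test'[OF h_sum, of 0]])
        (simp add: norm_mult norm_power mult_left_le power_le_one)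
    then show ?thesis using z
      unfolding eval_fps_def by (subst suminf_diff) (auto simp: h_def algebra_simps summable_levy)
  qed
  finally show ?thesis by (simp add: eval_fps_def f_def)
qed

lemma pmf_char:
  assumes "a \<ge> 0"
  shows "(CLINT n | measure_pmf (\<mu> a). iexp (w * real n)) =
    exp (of_real a * (\<Sum>k. of_real (levy k) * (iexp (w * real k) - 1)))"
proof -
  have pow: "iexp (w * real n) = iexp w ^ n" for n
    by (simp add: exp_of_nat_mult[symmetric] algebra_simps)
  have "(CLINT n | measure_pmf (\<mu> a). iexp (w * real n)) = (CLINT n | measure_pmf (\<mu> a). iexp w ^ n)"
    by (simp only: pow)
  also have "\<dots> = infsetsum (\<lambda>n. pmf (\<mu> a) n *\<^sub>R iexp w ^ n) UNIV"
    unfolding infsetsum_def measure_pmf_eq_density by (subst integral_density) simp_all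
  also have "\<dots> = (\<Sum>n. of_real (pmf (\<mu> a) n) * iexp w ^ n)"
    by (subst infsetsum_nat') (auto simp: abs_summable_on_nat_iff' scaleR_conv_of_real norm_mult
        norm_power sums_summable[OF pmf_nat_sums])
  also have "\<dots> = exp (of_real a * (\<Sum>k. of_real (levy k) * (iexp w ^ k - 1)))"
    by (rule generating_function[OF assms]) simp
  finally show ?thesis by (simp only: pow)
qed

text \<open>Only the term \<open>i = 0\<close> of the recursion survives, which leaves the recursion
  of the Poisson weights. The bound \<open>k \<le> n\<close> in the hypothesis lets the lemma be
  used inside the induction of \<open>levy_eq_zero_if_ratio\<close>.\<close>

lemma pmf_eq_poisson_weight:
  assumes a: "a \<ge> 0" and zero: "\<And>k. 2 \<le> k \<Longrightarrow> k \<le> n \<Longrightarrow> levy k = 0"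
  shows "pmf (\<mu> a) n = pmf (\<mu> a) 0 * (levy 1 * a) ^ n / fact n"
  using zero
proof (induction n)
  case (Suc n)
  have "(\<Sum>i\<le>n. real (Suc i) * levy (Suc i) * pmf (\<mu> a) (n - i)) =
      (\<Sum>i\<in>{0}. real (Suc i) * levy (Suc i) * pmf (\<mu> a) (n - i))"
    by (rule sum.mono_neutral_right) (auto intro!: Suc.prems)
  then have "real (Suc n) * pmf (\<mu> a) (Suc n) = levy 1 * a * pmf (\<mu> a) n"
    using pmf_recursion[OF a, of n] by simp
  then have "pmf (\<mu> a) (Suc n) = levy 1 * a * pmf (\<mu> a) n / real (Suc n)"
    by (simp add: field_simps del: of_nat_Suc)
  then show ?case using Suc by (simp add: mult_ac)
qed simp

text \<open>All masses are Poisson weights up to the factor \<open>pmf (\<mu> a) 0\<close>, and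
  summing them to 1 identifies this factor. The rate \<open>levy 1\<close> is positive because
  \<open>\<mu> 1\<close> charges 1.\<close>

lemma poisson_family_if_levy:
  assumes zero: "\<And>k. k \<ge> 2 \<Longrightarrow> levy k = 0"
  shows "poisson_family \<mu>"
proof -
  have rec: "pmf (\<mu> a) n = pmf (\<mu> a) 0 * (levy 1 * a) ^ n / fact n" if "a \<ge> 0" for a n
    using that zero by (rule pmf_eq_poisson_weight)
  have pos: "levy 1 > 0"
    using rec[of 1 1] pmf_one_pos[of 1] pmf_zero_pos[of 1] by (simp add: zero_less_mult_iff)
  have zero_eq: "pmf (\<mu> a) 0 = exp (- (levy 1 * a))" if "a \<ge> 0" for a
  proof -
    have "(\<lambda>n. pmf (\<mu> a) 0 * ((levy 1 * a) ^ n /\<^sub>R fact n)) sums (pmf (\<mu> a) 0 * exp (levy 1 * a))"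
      by (intro sums_mult exp_converges)
    moreover have "(\<lambda>n. pmf (\<mu> a) 0 * ((levy 1 * a) ^ n /\<^sub>R fact n)) = pmf (\<mu> a)"
    proof
      fix n
      show "pmf (\<mu> a) 0 * ((levy 1 * a) ^ n /\<^sub>R fact n) = pmf (\<mu> a) n"
        using rec[OF that, of n] by (simp add: field_simps)
    qed
    ultimately have "pmf (\<mu> a) 0 * exp (levy 1 * a) = 1"
      using pmf_nat_sums[of "\<mu> a"] by (simp add: sums_unique2)
    then show ?thesis by (simp add: exp_minus field_simps)
  qed
  have "\<mu> a = poisson_pmf (levy 1 * a)" if "a > 0" for a
    by (rule pmf_eqI) (use that pos in
        \<open>simp add: poisson_pmf.rep_eq pmf_poisson rec[of a] zero_eq less_imp_le\<close>)
  then show ?thesis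
    unfolding poisson_family_def using pos pmf_at_zero by (intro exI[of _ "levy 1"]) simp
qed


text \<open>As \<open>(\<theta> * r\<^sup>2) * \<theta> = (\<theta> * r)\<^sup>2\<close>, pure
  Poisson weights satisfy the identity exactly. In a strong induction, the first nonzero higher
  weight would enter as a perturbation of them, and the identity at \<open>n = k\<close> excludes
  it.\<close>

lemma levy_eq_zero_if_ratio:
  assumes \<theta>: "\<theta> > 0" and r: "0 < r" "r < 1" and k: "k \<ge> 2"
    and ratio: "\<And>n. (pmf (\<mu> (\<theta> * r\<^sup>2)) n / pmf (\<mu> (\<theta> * r\<^sup>2)) 0) * (pmf (\<mu> \<theta>) n / pmf (\<mu> \<theta>) 0) =
      (pmf (\<mu> (\<theta> * r)) n / pmf (\<mu> (\<theta> * r)) 0)\<^sup>2"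
  shows "levy k = 0"
  using k
proof (induction k rule: less_induct)
  case (less k)
  then have zero: "levy j = 0" if "2 \<le> j" "j < k" for j using that by blast
  obtain m where m: "k = Suc m" "m \<ge> 1" using less.prems by (cases k) auto
  have weight: "pmf (\<mu> a) k / pmf (\<mu> a) 0 = (levy 1 * a) ^ k / fact k + a * levy k" if a: "a \<ge> 0" for a
  proof -
    \<comment> \<open>At index \<open>k = Suc m\<close> the term \<open>i = 0\<close> continues the
      Poisson weights and \<open>i = m\<close> brings in the new weight \<open>levy k\<close>; the
      others vanish by induction. Since \<open>m \<ge> 1\<close>, these two terms are
      distinct.\<close>
    have "(\<Sum>i\<le>m. real (Suc i) * levy (Suc i) * pmf (\<mu> a) (m - i)) =
        (\<Sum>i\<in>{0, m}. real (Suc i) * levy (Suc i) * pmf (\<mu> a) (m - i))"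
      by (rule sum.mono_neutral_right) (use m zero in auto)
    also have "\<dots> = levy 1 * pmf (\<mu> a) m + real k * levy k * pmf (\<mu> a) 0"
      using m by simp
    finally have "real k * pmf (\<mu> a) k = a * (levy 1 * pmf (\<mu> a) m + real k * levy k * pmf (\<mu> a) 0)"
      using pmf_recursion[OF a, of m] m by simp
    also have "pmf (\<mu> a) m = pmf (\<mu> a) 0 * (levy 1 * a) ^ m / fact m"
      by (rule pmf_eq_poisson_weight[OF a]) (use zero m in auto)
    finally show ?thesis
      using pmf_zero_pos[OF a] m by (simp add: field_simps fact_Suc del: of_nat_Suc)
  qed
  define u where "u = (levy 1 * \<theta>) ^ k / fact k"
  have "pmf (\<mu> 1) 1 = pmf (\<mu> 1) 0 * levy 1"
    using pmf_recursion[of 1 0] by simp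
  then have "levy 1 > 0"
    using pmf_one_pos[of 1] pmf_zero_pos[of 1] by (simp add: zero_less_mult_iff)
  then have u: "u > 0" using \<theta> by (simp add: u_def)
  have "(u * (r\<^sup>2) ^ k + \<theta> * r\<^sup>2 * levy k) * (u + \<theta> * levy k) = (u * r ^ k + \<theta> * r * levy k)\<^sup>2"
    using ratio[of k] \<theta> r by (simp add: weight u_def power_mult_distrib mult.assoc)
  moreover define R where "R = r ^ k"
  moreover have "(r\<^sup>2) ^ k = R\<^sup>2" by (simp add: R_def power_mult[symmetric] mult.commute)
  ultimately have "(u * R\<^sup>2 + \<theta> * r\<^sup>2 * levy k) * (u + \<theta> * levy k) = (u * R + \<theta> * r * levy k)\<^sup>2"
    by simp
  \<comment> \<open>The terms in \<open>u\<^sup>2\<close> and in \<open>(levy k)\<^sup>2\<close>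
    cancel, and the mixed terms form a perfect square. Its base \<open>R - r\<close> is nonzero
    because \<open>k \<ge> 2\<close> and \<open>0 < r < 1\<close>.\<close>
  then have "u * \<theta> * levy k * (R - r)\<^sup>2 = 0" by algebra
  moreover have "r ^ k < r"
    using power_strict_decreasing[of 1 k r] r less.prems by simp
  ultimately show "levy k = 0" using u \<theta> by (simp add: R_def)
qed

end

section \<open>Random measures\<close>

text \<open>Independence of the random measure is given for sequences indexed by \<open>nat\<close>;
  this relabelling carries it over to other index sets. The chosen events are moved to the image of
  \<open>f\<close> by its inverse.\<close>

lemma (in prob_space) indep_vars_reindex:
  assumes inj: "inj_on f I" and indep: "indep_vars M' X (f ` I)"
  shows "indep_vars (\<lambda>i. M' (f i)) (\<lambda>i. X (f i)) I"
  unfolding indep_vars_def2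
proof (intro conjI ballI indep_setsI)
  fix i assume "i \<in> I"
  then show "random_variable (M' (f i)) (X (f i))"
    using indep by (simp add: indep_vars_def2)
  then show "{X (f i) -` A \<inter> space M |A. A \<in> sets (M' (f i))} \<subseteq> events" by auto
next
  fix A J assume J: "J \<noteq> {}" "J \<subseteq> I" "finite J"
    and A: "\<forall>j\<in>J. A j \<in> {X (f j) -` A \<inter> space M |A. A \<in> sets (M' (f j))}"
  define A' where "A' k = A (the_inv_into J f k)" for k
  have injJ: "inj_on f J" using inj J(2) by (rule inj_on_subset)
  have A'_f [simp]: "A' (f j) = A j" if "j \<in> J" for j
    using the_inv_into_f_f[OF injJ that] by (simp add: A'_def)
  have "indep_sets (\<lambda>k. {X k -` A \<inter> space M |A. A \<in> sets (M' k)}) (f ` I)"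
    using indep by (simp add: indep_vars_def2)
  then have "prob (\<Inter>k\<in>f ` J. A' k) = (\<Prod>k\<in>f ` J. prob (A' k))"
    by (rule indep_setsD) (use J A in auto)
  then show "prob (\<Inter>j\<in>J. A j) = (\<Prod>j\<in>J. prob (A j))"
    by (simp add: prod.reindex[OF injJ])
qed

definition finite_area :: "(real \<times> real) set \<Rightarrow> bool" where
  "finite_area A \<longleftrightarrow> A \<in> sets borel \<and> emeasure lborel A < \<infinity>"

lemma finite_area_empty [simp]: "finite_area {}"
  by (simp add: finite_area_def)

lemma finite_area_borel: "finite_area A \<Longrightarrow> A \<in> sets borel"
  by (simp add: finite_area_def)

lemma finite_area_subset: "finite_area A \<Longrightarrow> B \<in> sets borel \<Longrightarrow> B \<subseteq> A \<Longrightarrow> finite_area B"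
  using emeasure_mono[of B A lborel] by (auto simp: finite_area_def)

lemma finite_area_Un: "finite_area A \<Longrightarrow> finite_area B \<Longrightarrow> finite_area (A \<union> B)"
  using emeasure_subadditive[of A lborel B] by (auto simp: finite_area_def less_top[symmetric] top_unique)

lemma finite_area_Diff: "finite_area A \<Longrightarrow> finite_area B \<Longrightarrow> finite_area (A - B)"
  by (rule finite_area_subset) (auto simp: finite_area_def)

locale nat_random_measure = prob_space M + nat_convolution_semigroup \<mu>
  for M :: "'w measure" and \<mu> +
  fixes N :: "'w \<Rightarrow> (real \<times> real) measure"
  assumes random_measure: "independent_random_measure M \<mu> N"
begin

lemma sets_N: "\<omega> \<in> space M \<Longrightarrow> sets (N \<omega>) = sets borel"
  using random_measure by (simp add: independent_random_measure_def)

lemma measurable_emeasure_N [measurable]: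
  "A \<in> sets borel \<Longrightarrow> (\<lambda>\<omega>. emeasure (N \<omega>) A) \<in> borel_measurable M"
  using random_measure by (simp add: independent_random_measure_def)

lemma measurable_measure_N [measurable]:
  "A \<in> sets borel \<Longrightarrow> (\<lambda>\<omega>. measure (N \<omega>) A) \<in> borel_measurable M"
  unfolding measure_def by (intro borel_measurable_enn2real measurable_emeasure_N)

lemma distr_N: "finite_area A \<Longrightarrow> distr M borel (\<lambda>\<omega>. emeasure (N \<omega>) A) =
    distr (measure_pmf (\<mu> (measure lborel A))) borel (\<lambda>n. of_nat n :: ennreal)"
  using random_measure by (simp add: independent_random_measure_def finite_area_def)

lemma AE_N_nat:
  assumes A: "finite_area A"
  shows "AE \<omega> in M. \<exists>n. emeasure (N \<omega>) A = of_nat n"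
proof -
  have [measurable]: "A \<in> sets borel" using A by (rule finite_area_borel)
  have "AE x in distr M borel (\<lambda>\<omega>. emeasure (N \<omega>) A). \<exists>n. x = of_nat n"
    unfolding distr_N[OF A] by (subst AE_distr_iff) auto
  then show ?thesis by (subst (asm) AE_distr_iff) auto
qed

lemma AE_N_finite: "finite_area A \<Longrightarrow> AE \<omega> in M. emeasure (N \<omega>) A < \<infinity>"
  by (rule AE_mp[OF AE_N_nat]) (auto intro!: AE_I2 simp: less_top[symmetric])

lemma prob_N_eq:
  assumes A: "finite_area A"
  shows "prob {\<omega> \<in> space M. emeasure (N \<omega>) A = of_nat n} = pmf (\<mu> (measure lborel A)) n"
proof -
  have [measurable]: "A \<in> sets borel" using A by (rule finite_area_borel)
  have "prob {\<omega> \<in> space M. emeasure (N \<omega>) A = of_nat n} =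
      measure (distr M borel (\<lambda>\<omega>. emeasure (N \<omega>) A)) {of_nat n}"
    by (subst measure_distr) (auto intro!: arg_cong[where f = prob])
  also have "\<dots> = measure (measure_pmf (\<mu> (measure lborel A))) ((\<lambda>n. of_nat n :: ennreal) -` {of_nat n})"
    unfolding distr_N[OF A] by (subst measure_distr) auto
  also have "(\<lambda>n. of_nat n :: ennreal) -` {of_nat n} = {n}" by auto
  finally show ?thesis by (simp add: pmf.rep_eq)
qed

lemma char_N:
  assumes A: "finite_area A"
  shows "(CLINT \<omega> | M. iexp (w * measure (N \<omega>) A)) =
    exp (of_real (measure lborel A) * (\<Sum>k. of_real (levy k) * (iexp (w * real k) - 1)))"
proof -
  have [measurable]: "A \<in> sets borel" using A by (rule finite_area_borel)
  have "(CLINT \<omega> | M. iexp (w * measure (N \<omega>) A)) =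
      (CLINT x | distr M borel (\<lambda>\<omega>. emeasure (N \<omega>) A). iexp (w * enn2real x))"
    by (subst integral_distr) (auto simp: measure_def)
  also have "\<dots> = (CLINT n | measure_pmf (\<mu> (measure lborel A)). iexp (w * real n))"
    unfolding distr_N[OF A] by (subst integral_distr) auto
  finally show ?thesis by (simp only: pmf_char[OF measure_nonneg])
qed

text \<open>The sets are numbered by an enumeration of \<open>I\<close> and the remaining naturals
  get the empty set, which yields a disjoint sequence as the definition demands.\<close>

lemma indep_vars_N:
  assumes fin: "finite I" and A: "\<And>i. i \<in> I \<Longrightarrow> finite_area (A i)" and disj: "disjoint_family_on A I"
  shows "indep_vars (\<lambda>_. borel) (\<lambda>i \<omega>. emeasure (N \<omega>) (A i)) I"
proof -
  obtain h where h: "bij_betw h I {0..<card I}"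
    using ex_bij_betw_finite_nat[OF fin] by blast
  then have inj: "inj_on h I" by (simp add: bij_betw_def)
  define B where "B j = (if j \<in> h ` I then A (the_inv_into I h j) else {})" for j
  have B_h: "B (h i) = A i" if "i \<in> I" for i
    using that the_inv_into_f_f[OF inj] by (simp add: B_def)
  have "disjoint_family B"
    unfolding disjoint_family_on_def
  proof (intro ballI impI)
    fix j k :: nat assume "j \<noteq> k"
    show "B j \<inter> B k = {}"
    proof (cases "j \<in> h ` I \<and> k \<in> h ` I")
      case True
      then obtain i i' where "i \<in> I" "i' \<in> I" "j = h i" "k = h i'" by blast
      moreover from this \<open>j \<noteq> k\<close> have "A i \<inter> A i' = {}"
        by (intro disjoint_family_onD[OF disj]) auto
      ultimately show ?thesis by (simp add: B_h)
    qed (auto simp: B_def)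
  qed
  moreover have "finite_area (B j)" for j
    using A B_h by (cases "j \<in> h ` I") (auto simp: B_def)
  ultimately have "indep_vars (\<lambda>_. borel) (\<lambda>i \<omega>. emeasure (N \<omega>) (B i)) UNIV"
    using random_measure by (simp add: independent_random_measure_def finite_area_def)
  then have "indep_vars (\<lambda>_. borel) (\<lambda>i \<omega>. emeasure (N \<omega>) (B (h i))) I"
    by (intro indep_vars_reindex[OF inj]) (rule indep_vars_subset, auto)
  then show ?thesis
    by (subst indep_vars_cong[OF refl, of I _ "\<lambda>i \<omega>. emeasure (N \<omega>) (B (h i))" _ "\<lambda>_. borel"]) (auto simp: B_h)
qed

text \<open>When \<open>B\<close> has no mass, counting \<open>A\<close> is the same as counting
  \<open>A - B\<close>, and \<open>B\<close> and \<open>A - B\<close> are disjoint, hence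
  independent.\<close>

lemma prob_void_count:
  assumes B: "finite_area B" and A: "finite_area A"
  shows "prob {\<omega> \<in> space M. emeasure (N \<omega>) B = 0 \<and> emeasure (N \<omega>) A = of_nat n} =
    pmf (\<mu> (measure lborel B)) 0 * pmf (\<mu> (measure lborel (A - B))) n"
proof -
  note [measurable] = finite_area_borel[OF A] finite_area_borel[OF B]
  define C where "C b = (if b then B else A - B)" for b
  have C: "finite_area (C b)" for b using A B by (simp add: C_def finite_area_Diff)
  have "indep_vars (\<lambda>_. borel) (\<lambda>b \<omega>. emeasure (N \<omega>) (C b)) (UNIV :: bool set)"
    by (intro indep_vars_N C) (auto simp: C_def disjoint_family_on_def)
  from indep_varsD_finite[OF this, of "\<lambda>b. if b then {0} else {of_nat n}"]
  have indep: "prob (\<Inter>b. (\<lambda>\<omega>. emeasure (N \<omega>) (C b)) -` (if b then {0} else {of_nat n}) \<inter> space M) =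
      (\<Prod>b\<in>UNIV. prob ((\<lambda>\<omega>. emeasure (N \<omega>) (C b)) -` (if b then {0} else {of_nat n}) \<inter> space M))"
    by simp
  have split: "emeasure (N \<omega>) A = emeasure (N \<omega>) (A - B)"
    if "\<omega> \<in> space M" "emeasure (N \<omega>) B = 0" for \<omega>
  proof -
    have s: "A \<in> sets (N \<omega>)" "B \<in> sets (N \<omega>)" using sets_N[OF that(1)] by auto
    then show ?thesis using that(2) by (intro emeasure_Diff_null_set[symmetric]) (auto intro: null_setsI)
  qed
  have "{\<omega> \<in> space M. emeasure (N \<omega>) B = 0 \<and> emeasure (N \<omega>) A = of_nat n} =
      (\<Inter>b. (\<lambda>\<omega>. emeasure (N \<omega>) (C b)) -` (if b then {0} else {of_nat n}) \<inter> space M)"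
    using split by (auto simp: C_def UNIV_bool)
  also have "prob \<dots> = prob {\<omega> \<in> space M. emeasure (N \<omega>) B = of_nat 0} *
      prob {\<omega> \<in> space M. emeasure (N \<omega>) (A - B) = of_nat n}"
    unfolding indep
    by (simp add: UNIV_bool C_def vimage_def Int_def conj_commute mult.commute)
  finally show ?thesis using prob_N_eq[OF B, of 0] prob_N_eq[OF finite_area_Diff[OF A B], of n] by simp
qed

text \<open>Two voids together are one void of \<open>B \<union> C\<close>. The choices
  \<open>B = C\<close> and \<open>B = C = {}\<close> impose fewer conditions, so this one formula
  supplies all four factors of the Markov identity.\<close>

lemma prob_void_void_count:
  assumes B: "finite_area B" and C: "finite_area C" and A: "finite_area A"
  shows "prob {\<omega> \<in> space M. measure (N \<omega>) B = 0 \<and> measure (N \<omega>) C = 0 \<and> measure (N \<omega>) A = real n} =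
    pmf (\<mu> (measure lborel (B \<union> C))) 0 * pmf (\<mu> (measure lborel (A - (B \<union> C)))) n"
proof -
  note [measurable] = finite_area_borel[OF A] finite_area_borel[OF B] finite_area_borel[OF C]
  have "prob {\<omega> \<in> space M. measure (N \<omega>) B = 0 \<and> measure (N \<omega>) C = 0 \<and> measure (N \<omega>) A = real n} =
      prob {\<omega> \<in> space M. emeasure (N \<omega>) (B \<union> C) = 0 \<and> emeasure (N \<omega>) A = of_nat n}"
  proof (rule measure_eq_AE)
    show "AE \<omega> in M. \<omega> \<in> {\<omega> \<in> space M. measure (N \<omega>) B = 0 \<and> measure (N \<omega>) C = 0 \<and> measure (N \<omega>) A = real n} \<longleftrightarrow>
      \<omega> \<in> {\<omega> \<in> space M. emeasure (N \<omega>) (B \<union> C) = 0 \<and> emeasure (N \<omega>) A = of_nat n}"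
      using AE_N_finite[OF A] AE_N_finite[OF B] AE_N_finite[OF C] AE_space
    proof eventually_elim
      case (elim \<omega>)
      have s: "B \<in> sets (N \<omega>)" "C \<in> sets (N \<omega>)" using sets_N[OF elim(4)] by auto
      have zero: "emeasure (N \<omega>) (B \<union> C) = 0 \<longleftrightarrow> emeasure (N \<omega>) B = 0 \<and> emeasure (N \<omega>) C = 0"
        using s emeasure_mono[of B "B \<union> C" "N \<omega>"] emeasure_mono[of C "B \<union> C" "N \<omega>"]
          emeasure_subadditive[OF s] by auto
      \<comment> \<open>\<open>measure\<close> assigns 0 to infinite mass, so the translation relies
        on finiteness, which holds almost surely.\<close>
      have eq: "emeasure (N \<omega>) D = of_nat m \<longleftrightarrow> measure (N \<omega>) D = real m"
        if "emeasure (N \<omega>) D < \<infinity>" for D m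
        using emeasure_eq_ennreal_measure[of "N \<omega>" D] that
        by (auto simp: ennreal_of_nat_eq_real_of_nat less_top[symmetric])
      show ?case using eq[OF elim(1), of n] eq[OF elim(2), of 0] eq[OF elim(3), of 0] zero by auto
    qed
  qed measurable
  then show ?thesis using prob_void_count[OF finite_area_Un[OF B C] A] by simp
qed

end

section \<open>Atoms of a finite family of sets and the joint law they determine\<close>

text \<open>The atom of \<open>S = {}\<close> is excluded below: it is the complement of all \<open>H t\<close> and has infinite area.\<close>

definition atom :: "('i \<Rightarrow> 'a set) \<Rightarrow> 'i set \<Rightarrow> 'i set \<Rightarrow> 'a set" where
  "atom H T S = (\<Inter>t\<in>S. H t) - (\<Union>t\<in>T - S. H t)"

text \<open>A point of an atom determines its index: \<open>S\<close> must be the set of all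
  \<open>t \<in> T\<close> whose \<open>H t\<close> contains the point.\<close>

lemma disjoint_family_on_atom: "disjoint_family_on (atom H T) (Pow T)"
proof (unfold disjoint_family_on_def, intro ballI impI)
  fix S S' assume S: "S \<in> Pow T" "S' \<in> Pow T" "S \<noteq> S'"
  have "S = {t \<in> T. x \<in> H t}" if "x \<in> atom H T S" "S \<in> Pow T" for x S
    using that by (auto simp: atom_def)
  with S show "atom H T S \<inter> atom H T S' = {}" by blast
qed

lemma UN_atom:
  assumes "t \<in> T"
  shows "(\<Union>S\<in>{S \<in> Pow T. t \<in> S}. atom H T S) = H t"
proof (rule Set.set_eqI)
  fix x
  have "x \<in> atom H T {t \<in> T. x \<in> H t}" if "x \<in> H t" using that by (auto simp: atom_def)
  then show "x \<in> (\<Union>S\<in>{S \<in> Pow T. t \<in> S}. atom H T S) \<longleftrightarrow> x \<in> H t"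
    using assms by (auto simp: atom_def intro!: exI[of _ "{t \<in> T. x \<in> H t}"])
qed

context nat_random_measure
begin

lemma finite_area_atom:
  assumes T: "finite T" and H: "\<And>t. t \<in> T \<Longrightarrow> finite_area (H t)" and S: "S \<in> Pow T - {{}}"
  shows "finite_area (atom H T S)"
proof -
  obtain t where t: "t \<in> S" using S by auto
  have fin: "finite S" using S T finite_subset by auto
  have "(\<Inter>t\<in>S. H t) \<in> sets borel"
    by (rule sets.finite_INT) (use S H t fin in \<open>auto simp: finite_area_def\<close>)
  moreover have "(\<Union>t\<in>T - S. H t) \<in> sets borel"
    by (rule sets.finite_UN) (use H T in \<open>auto simp: finite_area_def\<close>)
  ultimately show ?thesis
    by (intro finite_area_subset[OF H[of t]]) (use S t in \<open>auto simp: atom_def\<close>)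
qed

lemma emeasure_N_eq_sum_atoms:
  assumes T: "finite T" and H: "\<And>t. t \<in> T \<Longrightarrow> finite_area (H t)" and t: "t \<in> T" and \<omega>: "\<omega> \<in> space M"
  shows "emeasure (N \<omega>) (H t) = (\<Sum>S\<in>{S \<in> Pow T - {{}}. t \<in> S}. emeasure (N \<omega>) (atom H T S))"
proof -
  have eq: "{S \<in> Pow T - {{}}. t \<in> S} = {S \<in> Pow T. t \<in> S}" by auto
  have "(\<Sum>S\<in>{S \<in> Pow T. t \<in> S}. emeasure (N \<omega>) (atom H T S)) =
      emeasure (N \<omega>) (\<Union>S\<in>{S \<in> Pow T. t \<in> S}. atom H T S)"
  proof (rule sum_emeasure)
    show "atom H T ` {S \<in> Pow T. t \<in> S} \<subseteq> sets (N \<omega>)"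
      using finite_area_borel[OF finite_area_atom[of T H]] T H by (auto simp: sets_N[OF \<omega>])
    show "disjoint_family_on (atom H T) {S \<in> Pow T. t \<in> S}"
      by (rule disjoint_family_on_mono[OF _ disjoint_family_on_atom]) auto
  qed (use T in simp)
  then show ?thesis unfolding eq UN_atom[OF t] by simp
qed

text \<open>The counts of the atoms are independent, so their joint law is a product measure, and
  the vector of the process is a fixed measurable function of these counts. The right-hand side
  involves \<open>H\<close> only through the areas of the atoms, which is what
  \<open>fdd_cong_atoms\<close> exploits.\<close>

lemma fdd_eq_distr_atoms:
  assumes T: "finite T" "T \<noteq> {}" and H: "\<And>t. t \<in> T \<Longrightarrow> finite_area (H t)"
  shows "fdd M (\<lambda>t \<omega>. measure (N \<omega>) (H t)) T =
    distr (Pi\<^sub>M (Pow T - {{}})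
        (\<lambda>S. distr (measure_pmf (\<mu> (measure lborel (atom H T S)))) borel (\<lambda>n. of_nat n :: ennreal)))
      (Pi\<^sub>M T (\<lambda>_. borel)) (\<lambda>y. \<lambda>t\<in>T. enn2real (\<Sum>S\<in>{S \<in> Pow T - {{}}. t \<in> S}. y S))"
proof -
  let ?K = "Pow T - {{}}"
  let ?Y = "\<lambda>S \<omega>. emeasure (N \<omega>) (atom H T S)"
  have atoms: "finite_area (atom H T S)" if "S \<in> ?K" for S
    using finite_area_atom[OF T(1) H that] by simp
  have meas: "?Y S \<in> borel_measurable M" if "S \<in> ?K" for S
    using finite_area_borel[OF atoms[OF that]] by measurable
  have indep: "indep_vars (\<lambda>_. borel) ?Y ?K"
    by (rule indep_vars_N) (use T atoms in \<open>auto intro: disjoint_family_on_mono[OF _ disjoint_family_on_atom]\<close>)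
  have joint: "distr M (Pi\<^sub>M ?K (\<lambda>_. borel)) (\<lambda>\<omega>. \<lambda>S\<in>?K. ?Y S \<omega>) = Pi\<^sub>M ?K (\<lambda>S. distr M borel (?Y S))"
    by (subst indep_vars_iff_distr_eq_PiM'[symmetric]) (use T meas indep in auto)
  have "Pi\<^sub>M ?K (\<lambda>S. distr M borel (?Y S)) =
      Pi\<^sub>M ?K (\<lambda>S. distr (measure_pmf (\<mu> (measure lborel (atom H T S)))) borel (\<lambda>n. of_nat n :: ennreal))"
    by (rule PiM_cong) (use distr_N atoms in auto)
  note joint = joint[unfolded this]
  have "fdd M (\<lambda>t \<omega>. measure (N \<omega>) (H t)) T =
      distr M (Pi\<^sub>M T (\<lambda>_. borel))
        ((\<lambda>y. \<lambda>t\<in>T. enn2real (\<Sum>S\<in>{S \<in> ?K. t \<in> S}. y S)) \<circ> (\<lambda>\<omega>. \<lambda>S\<in>?K. ?Y S \<omega>))"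
    unfolding fdd_def
  proof (rule distr_cong)
    fix \<omega> assume \<omega>: "\<omega> \<in> space M"
    have "measure (N \<omega>) (H t) = enn2real (\<Sum>S\<in>{S \<in> ?K. t \<in> S}. (\<lambda>S\<in>?K. ?Y S \<omega>) S)" if t: "t \<in> T" for t
    proof -
      have "emeasure (N \<omega>) (H t) = (\<Sum>S\<in>{S \<in> ?K. t \<in> S}. (\<lambda>S\<in>?K. ?Y S \<omega>) S)"
        by (subst emeasure_N_eq_sum_atoms[of T H t \<omega>]) (use T H t \<omega> in \<open>auto intro!: sum.cong\<close>)
      then show ?thesis by (simp only: measure_def)
    qed
    then show "(\<lambda>t\<in>T. measure (N \<omega>) (H t)) =
        ((\<lambda>y. \<lambda>t\<in>T. enn2real (\<Sum>S\<in>{S \<in> ?K. t \<in> S}. y S)) \<circ> (\<lambda>\<omega>. \<lambda>S\<in>?K. ?Y S \<omega>)) \<omega>"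
      by (auto simp: restrict_def fun_eq_iff)
  qed auto
  also have "\<dots> = distr (distr M (Pi\<^sub>M ?K (\<lambda>_. borel)) (\<lambda>\<omega>. \<lambda>S\<in>?K. ?Y S \<omega>)) (Pi\<^sub>M T (\<lambda>_. borel))
      (\<lambda>y. \<lambda>t\<in>T. enn2real (\<Sum>S\<in>{S \<in> ?K. t \<in> S}. y S))"
  proof (rule distr_distr[symmetric])
    show "(\<lambda>y. \<lambda>t\<in>T. enn2real (\<Sum>S\<in>{S \<in> ?K. t \<in> S}. y S)) \<in>
        Pi\<^sub>M ?K (\<lambda>_. borel) \<rightarrow>\<^sub>M Pi\<^sub>M T (\<lambda>_. borel :: real measure)"
      by (intro measurable_restrict borel_measurable_enn2real borel_measurable_sum
          measurable_component_singleton) auto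
    show "(\<lambda>\<omega>. \<lambda>S\<in>?K. ?Y S \<omega>) \<in> M \<rightarrow>\<^sub>M Pi\<^sub>M ?K (\<lambda>_. borel)"
      by (intro measurable_restrict meas)
  qed
  finally show ?thesis unfolding joint .
qed

lemma fdd_cong_atoms:
  assumes T: "finite T" and H: "\<And>t. t \<in> T \<Longrightarrow> finite_area (H t)" and H': "\<And>t. t \<in> T \<Longrightarrow> finite_area (H' t)"
    and eq: "\<And>S. S \<in> Pow T - {{}} \<Longrightarrow> measure lborel (atom H T S) = measure lborel (atom H' T S)"
  shows "fdd M (\<lambda>t \<omega>. measure (N \<omega>) (H t)) T = fdd M (\<lambda>t \<omega>. measure (N \<omega>) (H' t)) T"
proof (cases "T = {}")
  case False
  have "Pi\<^sub>M (Pow T - {{}})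
        (\<lambda>S. distr (measure_pmf (\<mu> (measure lborel (atom H T S)))) borel (\<lambda>n. of_nat n :: ennreal)) =
      Pi\<^sub>M (Pow T - {{}})
        (\<lambda>S. distr (measure_pmf (\<mu> (measure lborel (atom H' T S)))) borel (\<lambda>n. of_nat n :: ennreal))"
    by (rule PiM_cong) (simp_all add: eq)
  then show ?thesis
    using fdd_eq_distr_atoms[OF T False H] fdd_eq_distr_atoms[OF T False H'] by simp
next
  case True
  show ?thesis unfolding fdd_def by (rule distr_cong) (simp_all add: True fun_eq_iff)
qed

text \<open>Each value is the sum over the atoms inside \<open>H t\<close>. Regrouping the linear
  form by atoms gives the count of the atom \<open>S\<close> the frequency
  \<open>\<Sum>t\<in>S. w t\<close>, and independence factors the expectation.\<close>

lemma char_fdd: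
  assumes T: "finite T" and H: "\<And>t. t \<in> T \<Longrightarrow> finite_area (H t)"
  shows "(CLINT x | fdd M (\<lambda>t \<omega>. measure (N \<omega>) (H t)) T. iexp (\<Sum>t\<in>T. w t * x t)) =
    exp (\<Sum>S\<in>Pow T - {{}}. of_real (measure lborel (atom H T S)) *
      (\<Sum>k. of_real (levy k) * (iexp ((\<Sum>t\<in>S. w t) * real k) - 1)))"
proof -
  let ?K = "Pow T - {{}}"
  let ?Y = "\<lambda>S \<omega>. measure (N \<omega>) (atom H T S)"
  have atoms: "finite_area (atom H T S)" if "S \<in> ?K" for S
    using finite_area_atom[OF T H that] by simp
  have [measurable]: "H t \<in> sets borel" if "t \<in> T" for t
    using H[OF that] by (rule finite_area_borel)
  have meas: "?Y S \<in> borel_measurable M" if "S \<in> ?K" for S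
    using finite_area_borel[OF atoms[OF that]] by measurable
  have "(CLINT x | fdd M (\<lambda>t \<omega>. measure (N \<omega>) (H t)) T. iexp (\<Sum>t\<in>T. w t * x t)) =
      (CLINT \<omega> | M. iexp (\<Sum>t\<in>T. w t * (\<lambda>t\<in>T. measure (N \<omega>) (H t)) t))"
    unfolding fdd_def
    by (rule integral_distr) (auto intro!: measurable_restrict measurable_measure_N)
  also have "\<dots> = (CLINT \<omega> | M. (\<Prod>S\<in>?K. iexp ((\<Sum>t\<in>S. w t) * ?Y S \<omega>)))"
  proof (rule integral_cong_AE)
    \<comment> \<open>Additivity passes from \<open>emeasure\<close> to real values because all
      atoms have finite mass, an almost sure statement.\<close>
    have "AE \<omega> in M. \<forall>S\<in>?K. emeasure (N \<omega>) (atom H T S) \<noteq> \<top>"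
      by (rule AE_finite_allI) (use T AE_N_finite[OF atoms] in \<open>auto simp: less_top\<close>)
    then show "AE \<omega> in M. iexp (\<Sum>t\<in>T. w t * (\<lambda>t\<in>T. measure (N \<omega>) (H t)) t) =
        (\<Prod>S\<in>?K. iexp ((\<Sum>t\<in>S. w t) * ?Y S \<omega>))"
      using AE_space
    proof eventually_elim
      case (elim \<omega>)
      have eq: "measure (N \<omega>) (H t) = (\<Sum>S\<in>{S \<in> ?K. t \<in> S}. ?Y S \<omega>)" if t: "t \<in> T" for t
      proof -
        have "emeasure (N \<omega>) (H t) = (\<Sum>S\<in>{S \<in> ?K. t \<in> S}. emeasure (N \<omega>) (atom H T S))"
          by (rule emeasure_N_eq_sum_atoms) (use T H t elim(2) in auto)
        also have "\<dots> = (\<Sum>S\<in>{S \<in> ?K. t \<in> S}. ennreal (?Y S \<omega>))"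
          by (rule sum.cong[OF refl], rule emeasure_eq_ennreal_measure) (use elim(1) in blast)
        also have "\<dots> = ennreal (\<Sum>S\<in>{S \<in> ?K. t \<in> S}. ?Y S \<omega>)"
          by (rule sum_ennreal) simp
        finally show ?thesis by (simp add: measure_def[of _ "H t"] sum_nonneg)
      qed
      have "(\<Sum>t\<in>T. w t * (\<lambda>t\<in>T. measure (N \<omega>) (H t)) t) =
          (\<Sum>t\<in>T. \<Sum>S\<in>{S \<in> ?K. t \<in> S}. w t * ?Y S \<omega>)"
        by (rule sum.cong[OF refl]) (simp add: eq sum_distrib_left)
      also have "\<dots> = (\<Sum>S\<in>?K. \<Sum>t\<in>{t \<in> T. t \<in> S}. w t * ?Y S \<omega>)"
        by (rule sum.swap_restrict) (use T in auto)
      also have "\<dots> = (\<Sum>S\<in>?K. (\<Sum>t\<in>S. w t) * ?Y S \<omega>)"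
        by (rule sum.cong[OF refl]) (auto simp: sum_distrib_right intro!: sum.cong)
      finally show ?case
        using T by (simp only: of_real_sum sum_distrib_left exp_sum finite_Diff finite_Pow_iff)
    qed
    have [measurable]: "(\<lambda>\<omega>. (\<lambda>t\<in>T. measure (N \<omega>) (H t)) t) \<in> borel_measurable M" if "t \<in> T" for t
      using that by simp
    show "(\<lambda>\<omega>. iexp (\<Sum>t\<in>T. w t * (\<lambda>t\<in>T. measure (N \<omega>) (H t)) t)) \<in> borel_measurable M"
      by measurable
    note [measurable] = meas
    show "(\<lambda>\<omega>. \<Prod>S\<in>?K. iexp ((\<Sum>t\<in>S. w t) * ?Y S \<omega>)) \<in> borel_measurable M"
      by measurable
  qed
  also have "\<dots> = (\<Prod>S\<in>?K. CLINT \<omega> | M. iexp ((\<Sum>t\<in>S. w t) * ?Y S \<omega>))"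
  proof (rule indep_vars_lebesgue_integral)
    have "indep_vars (\<lambda>_. borel) (\<lambda>S \<omega>. emeasure (N \<omega>) (atom H T S)) ?K"
      by (rule indep_vars_N) (use T atoms in \<open>auto intro: disjoint_family_on_mono[OF _ disjoint_family_on_atom]\<close>)
    then have "indep_vars (\<lambda>_. borel)
        (\<lambda>S \<omega>. iexp ((\<Sum>t\<in>S. w t) * enn2real (emeasure (N \<omega>) (atom H T S)))) ?K"
      by (rule indep_vars_compose2) measurable
    then show "indep_vars (\<lambda>_. borel) (\<lambda>S \<omega>. iexp ((\<Sum>t\<in>S. w t) * ?Y S \<omega>)) ?K"
      by (simp only: measure_def)
    show "integrable M (\<lambda>\<omega>. iexp ((\<Sum>t\<in>S. w t) * ?Y S \<omega>))" if "S \<in> ?K" for S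
      using meas[OF that] by (intro integrable_const_bound[where B = 1]) auto
  qed (use T in simp)
  also have "\<dots> = (\<Prod>S\<in>?K. exp (of_real (measure lborel (atom H T S)) *
      (\<Sum>k. of_real (levy k) * (iexp ((\<Sum>t\<in>S. w t) * real k) - 1))))"
    by (rule prod.cong[OF refl char_N[OF atoms]])
  finally show ?thesis using T by (simp only: exp_sum finite_Diff finite_Pow_iff)
qed

end

section \<open>Levy measures of the joint laws\<close>

context nat_convolution_semigroup
begin

text \<open>A jump of size \<open>k\<close> in the atom \<open>S\<close> moves the coordinates in
  \<open>S\<close> by \<open>k\<close> and no others, at rate \<open>c S * levy k\<close>. So
  \<open>\<nu>\<close> is the image under \<open>\<phi>\<close> of a discrete measure on the pairs
  \<open>(S, k)\<close>, finite because \<open>levy\<close> is summable and \<open>K\<close> is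
  finite.\<close>

lemma levy_measure_exists:
  fixes T :: "'i set" and c :: "'i set \<Rightarrow> real"
  assumes T: "finite T" and K: "K \<subseteq> Pow T" and c: "\<And>S. S \<in> K \<Longrightarrow> 0 \<le> c S"
  shows "\<exists>\<nu> :: ('i \<Rightarrow> int) measure.
    sets \<nu> = sets (Pi\<^sub>M T (\<lambda>_. count_space UNIV)) \<and> finite_measure \<nu> \<and>
    (\<forall>w :: 'i \<Rightarrow> real. (CLINT u | \<nu>. (iexp (\<Sum>t\<in>T. w t * of_int (u t)) - 1)) =
      (\<Sum>S\<in>K. of_real (c S) * (\<Sum>k. of_real (levy k) * (iexp ((\<Sum>t\<in>S. w t) * real k) - 1))))"
proof -
  have finK: "finite K" using T K by (meson finite_Pow_iff finite_subset)
  define q where "q = (\<lambda>(S, k). c S * levy k)"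
  define \<phi> :: "'i set \<times> nat \<Rightarrow> 'i \<Rightarrow> int" where "\<phi> = (\<lambda>(S, k). \<lambda>t\<in>T. if t \<in> S then int k else 0)"
  define base where "base = density (count_space (K \<times> UNIV)) (\<lambda>x. ennreal (q x))"
  define \<nu> where "\<nu> = distr base (Pi\<^sub>M T (\<lambda>_. count_space UNIV)) \<phi>"
  have q_nonneg: "0 \<le> q x" if "x \<in> K \<times> UNIV" for x
    using that c levy_nonneg by (auto simp: q_def)
  have summable_q: "Infinite_Set_Sum.abs_summable_on q (K \<times> UNIV)"
    by (subst abs_summable_on_Sigma_iff)
      (auto simp: finK countable_finite q_def abs_summable_on_nat_iff' abs_mult
        intro!: summable_mult summable_levy simp: levy_nonneg)
  then have int_q: "integrable (count_space (K \<times> UNIV)) q"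
    by (simp add: Infinite_Set_Sum.abs_summable_on_def)
  have [measurable]: "\<phi> \<in> base \<rightarrow>\<^sub>M Pi\<^sub>M T (\<lambda>_. count_space UNIV)"
    by (auto simp: base_def \<phi>_def space_PiM)
  have "finite_measure base"
  proof
    have "emeasure base (space base) = (\<integral>\<^sup>+x. ennreal (q x) \<partial>count_space (K \<times> UNIV))"
      by (auto simp: base_def emeasure_density intro!: nn_integral_cong)
    also have "\<dots> = ennreal (integral\<^sup>L (count_space (K \<times> UNIV)) q)"
      by (rule nn_integral_eq_integral[OF int_q]) (simp add: AE_count_space q_nonneg)
    finally show "emeasure base (space base) \<noteq> \<infinity>" by simp
  qed
  then have "finite_measure \<nu>"
    unfolding \<nu>_def by (rule finite_measure.finite_measure_distr) simp
  moreover have "(CLINT u | \<nu>. (iexp (\<Sum>t\<in>T. w t * of_int (u t)) - 1)) =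
      (\<Sum>S\<in>K. of_real (c S) * (\<Sum>k. of_real (levy k) * (iexp ((\<Sum>t\<in>S. w t) * real k) - 1)))"
    for w :: "'i \<Rightarrow> real"
  proof -
    define e where "e = (\<lambda>(S, k). iexp ((\<Sum>t\<in>S. w t) * real k) - 1)"
    have "(CLINT u | \<nu>. (iexp (\<Sum>t\<in>T. w t * of_int (u t)) - 1)) =
        (CLINT x | base. (iexp (\<Sum>t\<in>T. w t * of_int (\<phi> x t)) - 1))"
      unfolding \<nu>_def by (rule integral_distr) measurable
    also have "\<dots> = (CLINT x | count_space (K \<times> UNIV). q x *\<^sub>R (iexp (\<Sum>t\<in>T. w t * of_int (\<phi> x t)) - 1))"
      unfolding base_def by (rule integral_density) (auto simp: AE_count_space q_nonneg)
    also have "\<dots> = infsetsum (\<lambda>x. q x *\<^sub>R e x) (K \<times> UNIV)"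
      unfolding infsetsum_def
    proof (rule Bochner_Integration.integral_cong[OF refl])
      fix x assume "x \<in> space (count_space (K \<times> (UNIV :: nat set)))"
      then obtain S k where x: "x = (S, k)" "S \<in> K" by auto
      have "(\<Sum>t\<in>T. w t * of_int (\<phi> x t)) = (\<Sum>t\<in>T. if t \<in> S then w t * real k else 0)"
        unfolding x \<phi>_def by (intro sum.cong) auto
      also have "\<dots> = (\<Sum>t\<in>S. w t) * real k"
        using x(2) K T by (simp add: sum.inter_restrict[symmetric] sum_distrib_right Int_absorb1 subset_iff)
      finally show "q x *\<^sub>R (iexp (\<Sum>t\<in>T. w t * of_int (\<phi> x t)) - 1) = q x *\<^sub>R e x"
        by (simp add: x e_def)
    qed
    also have "\<dots> = infsetsum (\<lambda>S. infsetsum (\<lambda>k. q (S, k) *\<^sub>R e (S, k)) UNIV) K"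
    proof (rule infsetsum_Sigma)
      \<comment> \<open>A bounded integrand against the summable weights \<open>q\<close> permits
        iterated summation.\<close>
      have "norm (e x) \<le> 2" for x
        unfolding e_def by (cases x) (auto intro!: order_trans[OF norm_triangle_ineq4])
      then have "norm (q x *\<^sub>R e x) \<le> norm (2 * q x)" for x
        using mult_left_mono[of "norm (e x)" 2 "\<bar>q x\<bar>"] by (simp add: abs_mult)
      then show "Infinite_Set_Sum.abs_summable_on (\<lambda>x. q x *\<^sub>R e x) (K \<times> UNIV)"
        by (intro abs_summable_on_comparison_test[OF abs_summable_on_cmult_right[OF summable_q, of 2]])
    qed (auto simp: finK countable_finite)
    also have "\<dots> = (\<Sum>S\<in>K. of_real (c S) * (\<Sum>k. of_real (levy k) * (iexp ((\<Sum>t\<in>S. w t) * real k) - 1)))"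
      unfolding infsetsum_finite[OF finK]
    proof (rule sum.cong[OF refl])
      fix S assume S: "S \<in> K"
      have bound: "norm (of_real (levy k) * (iexp ((\<Sum>t\<in>S. w t) * real k) - 1)) \<le> 2 * levy k" for k
        using mult_left_mono[OF order_trans[OF norm_triangle_ineq4], of "iexp ((\<Sum>t\<in>S. w t) * real k)" 1 2 "levy k"]
        by (simp add: norm_mult levy_nonneg mult.commute)
      have sum: "summable (\<lambda>k. norm (of_real (levy k) * (iexp ((\<Sum>t\<in>S. w t) * real k) - 1)))"
        by (rule summable_comparison_test'[OF summable_mult[OF summable_levy, of 2], of 0]) (use bound in simp)
      have sum': "summable (\<lambda>k. norm (of_real (c S) * (of_real (levy k) * (iexp ((\<Sum>t\<in>S. w t) * real k) - 1))))"
        using summable_mult[OF sum, of "\<bar>c S\<bar>"] by (simp add: norm_mult)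
      have "infsetsum (\<lambda>k. q (S, k) *\<^sub>R e (S, k)) UNIV =
          infsetsum (\<lambda>k. of_real (c S) * (of_real (levy k) * (iexp ((\<Sum>t\<in>S. w t) * real k) - 1))) UNIV"
        by (rule infsetsum_cong) (auto simp: q_def e_def scaleR_conv_of_real)
      also have "\<dots> = (\<Sum>k. of_real (c S) * (of_real (levy k) * (iexp ((\<Sum>t\<in>S. w t) * real k) - 1)))"
        by (rule infsetsum_nat') (use sum' in \<open>simp only: abs_summable_on_nat_iff'\<close>)
      also have "\<dots> = of_real (c S) * (\<Sum>k. of_real (levy k) * (iexp ((\<Sum>t\<in>S. w t) * real k) - 1))"
        by (rule suminf_mult[OF summable_norm_cancel[OF sum]])
      finally show "infsetsum (\<lambda>k. q (S, k) *\<^sub>R e (S, k)) UNIV =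
          of_real (c S) * (\<Sum>k. of_real (levy k) * (iexp ((\<Sum>t\<in>S. w t) * real k) - 1))" .
    qed
    finally show ?thesis .
  qed
  moreover have "sets \<nu> = sets (Pi\<^sub>M T (\<lambda>_. count_space UNIV))"
    by (simp add: \<nu>_def)
  ultimately show ?thesis by blast
qed

end

context nat_random_measure
begin

lemma infinitely_divisible_N:
  assumes H: "\<And>t. finite_area (H t)"
  shows "infinitely_divisible_process M (\<lambda>t \<omega>. measure (N \<omega>) (H t))"
  unfolding infinitely_divisible_process_def
proof (intro allI impI)
  fix T :: "int set" assume T: "finite T"
  obtain \<nu> :: "(int \<Rightarrow> int) measure" where \<nu>: "sets \<nu> = sets (Pi\<^sub>M T (\<lambda>_. count_space UNIV))" "finite_measure \<nu>"
    and char: "\<And>w :: int \<Rightarrow> real. (CLINT u | \<nu>. (iexp (\<Sum>t\<in>T. w t * of_int (u t)) - 1)) =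
      (\<Sum>S\<in>Pow T - {{}}. of_real (measure lborel (atom H T S)) *
        (\<Sum>k. of_real (levy k) * (iexp ((\<Sum>t\<in>S. w t) * real k) - 1)))"
    using levy_measure_exists[OF T Diff_subset[of "Pow T" "{{}}"], of "\<lambda>S. measure lborel (atom H T S)"]
    by auto
  show "\<exists>\<nu> :: (int \<Rightarrow> int) measure. sets \<nu> = sets (Pi\<^sub>M T (\<lambda>_. count_space UNIV)) \<and> finite_measure \<nu> \<and>
      (\<forall>w. (CLINT x | fdd M (\<lambda>t \<omega>. measure (N \<omega>) (H t)) T. iexp (\<Sum>t\<in>T. w t * x t)) =
        exp (CLINT u | \<nu>. (iexp (\<Sum>t\<in>T. w t * of_int (u t)) - 1)))"
    by (intro exI[of _ \<nu>] conjI allI \<nu>) (unfold char, rule char_fdd[OF T H])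
qed

lemma nonneg_integer_valued_N:
  assumes H: "\<And>t. finite_area (H t)"
  shows "nonneg_integer_valued M (\<lambda>t \<omega>. measure (N \<omega>) (H t))"
  unfolding nonneg_integer_valued_def
proof (intro allI conjI)
  fix t
  show "(\<lambda>\<omega>. measure (N \<omega>) (H t)) \<in> borel_measurable M"
    by (rule measurable_measure_N[OF finite_area_borel[OF H]])
  show "AE \<omega> in M. measure (N \<omega>) (H t) \<in> \<nat>"
    using AE_N_nat[OF H[of t]] by eventually_elim (auto simp: measure_def)
qed

end

section \<open>Areas\<close>

text \<open>Height and real centre are free parameters, unlike in \<open>G\<close>, so that the
  family is closed under the intersections computed in \<open>hill_Int_hill\<close>.\<close>

definition hill :: "real \<Rightarrow> real \<Rightarrow> real \<Rightarrow> (real \<times> real) set" where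
  "hill h l m = {(x, y). 0 \<le> y \<and> y < h * exp (- 2 * l * \<bar>m - x\<bar>)}"

lemma G_eq_hill: "G \<theta> l t = hill (\<theta> * l) l (of_int t)"
  by (simp add: G_def hill_def)

lemma hill_borel [measurable]: "hill h l m \<in> sets borel"
proof -
  have "hill h l m = {p \<in> space (borel \<Otimes>\<^sub>M borel). 0 \<le> snd p \<and> snd p < h * exp (- 2 * l * \<bar>m - fst p\<bar>)}"
    by (auto simp: hill_def space_pair_measure)
  also have "\<dots> \<in> sets (borel \<Otimes>\<^sub>M borel)" by measurable
  finally show ?thesis by (simp only: borel_prod)
qed

text \<open>After centring by a translation, the integral is split at 0; each half contributes
  \<open>h / (2 * l)\<close>, the left one by reflection.\<close>

lemma nn_integral_two_sided_exp:
  assumes h: "h \<ge> 0" and l: "l > 0"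
  shows "(\<integral>\<^sup>+x. ennreal (h * exp (- 2 * l * \<bar>m - x\<bar>)) \<partial>lborel) = ennreal (h / l)"
proof -
  define f where "f x = h * exp (- 2 * l * \<bar>x\<bar>)" for x :: real
  have [measurable]: "f \<in> borel_measurable borel" unfolding f_def by measurable
  have right: "(\<integral>\<^sup>+x. ennreal (f x) * indicator {0..} x \<partial>lborel) = ennreal (h / (2 * l))"
  proof -
    have "(\<integral>\<^sup>+x. ennreal (f x) * indicator {0..} x \<partial>lborel) =
        (\<integral>\<^sup>+x. ennreal (h * exp (- 2 * l * x)) * indicator {0..} x \<partial>lborel)"
      by (intro nn_integral_cong) (auto simp: f_def indicator_def)
    also have "\<dots> = ennreal (0 - (- (h / (2 * l)) * exp (- 2 * l * 0)))"
    proof (rule nn_integral_FTC_atLeast)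
      show "((\<lambda>x. - (h / (2 * l)) * exp (- 2 * l * x)) has_real_derivative h * exp (- 2 * l * x)) (at x)" for x
        using l by (auto intro!: derivative_eq_intros)
      have "filterlim (\<lambda>x. - 2 * l * x) at_bot at_top"
        using l by (intro filterlim_tendsto_neg_mult_at_bot[OF tendsto_const _ filterlim_ident]) auto
      then have "((\<lambda>x. exp (- 2 * l * x)) \<longlongrightarrow> 0) at_top"
        by (rule filterlim_compose[OF exp_at_bot])
      then show "((\<lambda>x. - (h / (2 * l)) * exp (- 2 * l * x)) \<longlongrightarrow> 0) at_top"
        by (rule tendsto_mult_right_zero)
    qed (use h in auto)
    finally show ?thesis by simp
  qed
  have "(\<integral>\<^sup>+x. ennreal (f x) * indicator {..<0} x \<partial>lborel) =
      (\<integral>\<^sup>+x. ennreal (f x) * indicator {0<..} x \<partial>lborel)"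
    by (subst nn_integral_real_affine[where c = "-1" and t = 0])
      (auto intro!: nn_integral_cong simp: f_def indicator_def)
  also have "\<dots> = (\<integral>\<^sup>+x. ennreal (f x) * indicator {0..} x \<partial>lborel)"
    by (rule nn_integral_cong_AE)
      (use AE_lborel_singleton[of "0 :: real"] in \<open>auto simp: indicator_def elim!: eventually_mono\<close>)
  finally have left: "(\<integral>\<^sup>+x. ennreal (f x) * indicator {..<0} x \<partial>lborel) = ennreal (h / (2 * l))"
    using right by simp
  have "(\<integral>\<^sup>+x. ennreal (h * exp (- 2 * l * \<bar>m - x\<bar>)) \<partial>lborel) = (\<integral>\<^sup>+x. ennreal (f x) \<partial>lborel)"
    by (subst nn_integral_real_affine[where c = 1 and t = m]) (simp_all add: f_def)
  also have "\<dots> = (\<integral>\<^sup>+x. ennreal (f x) * indicator {0..} x + ennreal (f x) * indicator {..<0} x \<partial>lborel)"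
    by (intro nn_integral_cong) (auto simp: indicator_def)
  also have "\<dots> = ennreal (h / (2 * l)) + ennreal (h / (2 * l))"
    by (subst nn_integral_add) (simp_all add: left right)
  also have "\<dots> = ennreal (h / l)"
    using h l by (simp add: ennreal_plus[symmetric] del: ennreal_plus)
  finally show ?thesis .
qed

lemma emeasure_lborel_pair:
  fixes A :: "(real \<times> real) set"
  assumes "A \<in> sets borel"
  shows "emeasure lborel A = (\<integral>\<^sup>+x. emeasure lborel (Pair x -` A) \<partial>lborel)"
proof -
  have "A \<in> sets (lborel \<Otimes>\<^sub>M lborel)" using assms by (simp only: lborel_prod sets_lborel)
  then show ?thesis by (subst lborel_prod[symmetric]) (rule lborel.emeasure_pair_measure_alt)
qed

lemma emeasure_hill:
  assumes "h \<ge> 0" "l > 0"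
  shows "emeasure lborel (hill h l m) = ennreal (h / l)"
proof -
  have "Pair x -` hill h l m = {0..<h * exp (- 2 * l * \<bar>m - x\<bar>)}" for x
    by (auto simp: hill_def)
  then show ?thesis
    using nn_integral_two_sided_exp[OF assms, of m] assms by (simp add: emeasure_lborel_pair)
qed

text \<open>The larger of the distances from \<open>x\<close> to \<open>a\<close> and
  \<open>b\<close> is \<open>\<bar>a - b\<bar> / 2\<close> plus the distance from \<open>x\<close>
  to the midpoint, so the minimum of the two exponentials is again one of the same kind, centred at
  the midpoint and damped by \<open>exp (- l * \<bar>a - b\<bar>)\<close>.\<close>

lemma hill_Int_hill:
  assumes h: "h > 0" and l: "l > 0"
  shows "hill h l a \<inter> hill h l b = hill (h * exp (- l * \<bar>a - b\<bar>)) l ((a + b) / 2)"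
proof -
  have "0 \<le> y \<and> y < h * exp (- 2 * l * \<bar>a - x\<bar>) \<and> y < h * exp (- 2 * l * \<bar>b - x\<bar>) \<longleftrightarrow>
      0 \<le> y \<and> y < h * exp (- l * \<bar>a - b\<bar>) * exp (- 2 * l * \<bar>(a + b) / 2 - x\<bar>)" for x y
  proof -
    have "y < h * exp (- 2 * l * \<bar>a - x\<bar>) \<and> y < h * exp (- 2 * l * \<bar>b - x\<bar>) \<longleftrightarrow>
        y < h * exp (- 2 * l * max \<bar>a - x\<bar> \<bar>b - x\<bar>)"
      using h l by (cases "\<bar>a - x\<bar> \<le> \<bar>b - x\<bar>") (auto simp: max_def elim!: less_le_trans)
    also have "max \<bar>a - x\<bar> \<bar>b - x\<bar> = \<bar>a - b\<bar> / 2 + \<bar>(a + b) / 2 - x\<bar>"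
      by (simp add: max_def abs_if field_simps)
    also have "- 2 * l * (\<bar>a - b\<bar> / 2 + \<bar>(a + b) / 2 - x\<bar>) = - l * \<bar>a - b\<bar> + - 2 * l * \<bar>(a + b) / 2 - x\<bar>"
      by (simp add: algebra_simps)
    finally show ?thesis by (simp only: exp_add mult.assoc)
  qed
  then show ?thesis by (auto simp: hill_def)
qed

text \<open>The map permutes the vertical sections, so by Fubini a change of variable in the outer
  integral suffices. The condition \<open>\<bar>c\<bar> = 1\<close> covers translations and
  reflections at once.\<close>

lemma emeasure_lborel_vimage_affine:
  fixes A :: "(real \<times> real) set"
  assumes A: "A \<in> sets borel" and c: "\<bar>c\<bar> = 1"
  shows "emeasure lborel ((\<lambda>(x, y). (m + c * x, y)) -` A) = emeasure lborel A"
proof -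
  let ?\<phi> = "\<lambda>(x, y). (m + c * x, y) :: real \<times> real"
  have "?\<phi> \<in> (borel \<Otimes>\<^sub>M borel) \<rightarrow>\<^sub>M (borel \<Otimes>\<^sub>M borel)" by measurable
  then have "?\<phi> \<in> borel \<rightarrow>\<^sub>M borel" by (simp add: borel_prod)
  from measurable_sets[OF this A] have B: "?\<phi> -` A \<in> sets borel" by simp
  have "A \<in> sets (lborel \<Otimes>\<^sub>M lborel)" using A by (simp only: lborel_prod sets_lborel)
  then have "(\<lambda>x. emeasure lborel (Pair x -` A)) \<in> borel_measurable lborel"
    by (rule lborel.measurable_emeasure_Pair)
  then have "(\<integral>\<^sup>+x. emeasure lborel (Pair x -` A) \<partial>lborel) =
      (\<integral>\<^sup>+x. emeasure lborel (Pair (m + c * x) -` A) \<partial>lborel)"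
    by (subst nn_integral_real_affine[where c = c and t = m]) (use c in auto)
  also have "\<dots> = (\<integral>\<^sup>+x. emeasure lborel (Pair x -` (?\<phi> -` A)) \<partial>lborel)"
    by (rule nn_integral_cong) (simp add: vimage_def)
  finally show ?thesis using A B by (simp add: emeasure_lborel_pair)
qed

lemma atom_vimage: "atom (\<lambda>t. \<phi> -` H t) T S = \<phi> -` atom H T S"
  by (auto simp: atom_def)

text \<open>Forming atoms commutes with preimages, so all atom areas are preserved. Stationarity and
  reversibility are both instances.\<close>

lemma (in nat_random_measure) fdd_vimage_affine:
  assumes T: "finite T" and H: "\<And>t. finite_area (H t)" and c: "\<bar>c\<bar> = 1"
  shows "fdd M (\<lambda>t \<omega>. measure (N \<omega>) ((\<lambda>(x, y). (m + c * x, y)) -` H t)) T =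
    fdd M (\<lambda>t \<omega>. measure (N \<omega>) (H t)) T"
proof (rule fdd_cong_atoms[OF T _ H])
  let ?\<phi> = "\<lambda>(x, y). (m + c * x, y) :: real \<times> real"
  have "?\<phi> \<in> (borel \<Otimes>\<^sub>M borel) \<rightarrow>\<^sub>M (borel \<Otimes>\<^sub>M borel)" by measurable
  then have "?\<phi> \<in> borel \<rightarrow>\<^sub>M borel" by (simp add: borel_prod)
  from measurable_sets[OF this] have "?\<phi> -` A \<in> sets borel" if "A \<in> sets borel" for A
    using that by simp
  then show "finite_area (?\<phi> -` H t)" for t
    using H[of t] emeasure_lborel_vimage_affine[OF _ c, of "H t" m] by (simp add: finite_area_def)
  show "measure lborel (atom (\<lambda>t. ?\<phi> -` H t) T S) = measure lborel (atom H T S)"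
    if "S \<in> Pow T - {{}}" for S
    unfolding atom_vimage measure_def
    using finite_area_borel[OF finite_area_atom[OF T H that]] by (simp add: emeasure_lborel_vimage_affine[OF _ c])
qed

section \<open>The Markov property\<close>

text \<open>The generated sigma-algebra consists of the preimages under \<open>X t\<close>, so the
  level set of \<open>f\<close> through \<open>\<omega>'\<close> cannot separate points with equal
  \<open>X t\<close>. Hence a conditional probability given the present is constant on each event
  \<open>X t = b\<close>.\<close>

lemma generated_sigma_measurable_singleton:
  assumes f: "f \<in> borel_measurable (generated_sigma M X {t})"
    and \<omega>: "\<omega> \<in> space M" "\<omega>' \<in> space M" "X t \<omega> = X t \<omega>'"
  shows "f \<omega> = (f \<omega>' :: real)"
proof -
  have "generated_sigma M X {t} = vimage_algebra (space M) (X t) borel"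
    by (simp add: generated_sigma_def vimage_algebra_def)
  then have sets: "sets (generated_sigma M X {t}) = {X t -` B \<inter> space M | B. B \<in> sets borel}"
    by (simp add: sets_vimage_algebra2)
  have "space (generated_sigma M X {t}) = space M"
    by (simp add: generated_sigma_def space_measure_of_conv)
  with measurable_sets[OF f, of "{f \<omega>'}"] obtain B where "f -` {f \<omega>'} \<inter> space M = X t -` B \<inter> space M"
    by (auto simp: sets)
  then show ?thesis using \<omega> by auto
qed

text \<open>Conditional independence of past and future given the present, with denominators cleared
  so that conditioning events of probability 0 are included.\<close>

lemma (in prob_space) markov_process_cond_indep:
  assumes markov: "markov_process M X" and X: "\<And>t. X t \<in> borel_measurable M" and order: "r \<le> t" "t \<le> u"
  shows "prob {\<omega> \<in> space M. X r \<omega> = a \<and> X t \<omega> = b \<and> X u \<omega> = c} * prob {\<omega> \<in> space M. X t \<omega> = b} =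
    prob {\<omega> \<in> space M. X r \<omega> = a \<and> X t \<omega> = b} * prob {\<omega> \<in> space M. X t \<omega> = b \<and> X u \<omega> = c}"
proof (cases "{\<omega> \<in> space M. X t \<omega> = b} = {}")
  case True
  then have "{\<omega> \<in> space M. X r \<omega> = a \<and> X t \<omega> = b} = {}" by blast
  with True show ?thesis by (simp only: measure_empty mult_zero_left mult_zero_right)
next
  case False
  then obtain \<omega>\<^sub>0 where \<omega>\<^sub>0: "\<omega>\<^sub>0 \<in> space M" "X t \<omega>\<^sub>0 = b" by blast
  note [measurable] = X
  define past where "past = generated_sigma M X {..t}"
  define present where "present = generated_sigma M X {t}"
  define D where "D = {\<omega> \<in> space M. X r \<omega> = a \<and> X t \<omega> = b}"
  define C where "C = {\<omega> \<in> space M. X t \<omega> = b}"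
  define E where "E = {\<omega> \<in> space M. X u \<omega> = c}"
  have [measurable]: "D \<in> sets M" "C \<in> sets M" "E \<in> sets M" by (simp_all add: D_def C_def E_def)
  have sets_gen: "sets (generated_sigma M X S) =
      sigma_sets (space M) (\<Union>s\<in>S. {X s -` B \<inter> space M | B. B \<in> sets borel})" for S
    unfolding generated_sigma_def by (rule sets_measure_of) auto
  have subalgebra: "subalgebra M (generated_sigma M X S)" for S
    unfolding subalgebra_def sets_gen
    by (auto simp: generated_sigma_def space_measure_of_conv intro!: sets.sigma_sets_subset)
  have gen: "{\<omega> \<in> space M. X s \<omega> = x} \<in> sets (generated_sigma M X S)" if "s \<in> S" for s S x
    unfolding sets_gen
    by (rule sigma_sets.Basic) (use that in \<open>auto intro!: bexI[of _ s] exI[of _ "{x}"]\<close>)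
  interpret past: finite_measure_subalgebra M past
    by unfold_locales (simp add: past_def subalgebra)
  interpret present: finite_measure_subalgebra M present
    by unfold_locales (simp add: present_def subalgebra)
  have "D = {\<omega> \<in> space M. X r \<omega> = a} \<inter> {\<omega> \<in> space M. X t \<omega> = b}" by (auto simp: D_def)
  then have D: "D \<in> sets past" using gen[of r "{..t}" a] gen[of t "{..t}" b] order by (auto simp: past_def)
  have C: "C \<in> sets present" using gen[of t "{t}" b] by (simp add: present_def C_def)
  have E_int: "integrable M (indicator E :: 'a \<Rightarrow> real)"
    by (rule integrable_real_indicator) (simp_all add: less_top[symmetric])
  \<comment> \<open>\<open>Z\<close> is one version of the conditional probability of
    \<open>E\<close> given the present. By the Markov property it also has the correct integral over
    the past event \<open>D\<close>, and it is constant on \<open>C\<close>; comparing its integrals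
    over \<open>D\<close> and \<open>C\<close> gives the product formula.\<close>
  define Z where "Z = real_cond_exp M present (indicator E)"
  have Z [measurable]: "Z \<in> borel_measurable M" unfolding Z_def by simp
  have "(LINT \<omega>:D|M. indicator E \<omega>) = (LINT \<omega>:D|M. real_cond_exp M past (indicator E) \<omega> :: real)"
    by (rule past.real_cond_exp_intA) (simp_all add: D E_int)
  also have "\<dots> = (LINT \<omega>:D|M. Z \<omega>)"
  proof (rule set_lebesgue_integral_cong_AE)
    let ?B = "{x \<in> space (Pi\<^sub>M {u} (\<lambda>_. borel)). x u = c} :: (int \<Rightarrow> real) set"
    have "?B \<in> sets (Pi\<^sub>M {u} (\<lambda>_. borel))" by measurable
    moreover have "{\<omega> \<in> space M. (\<lambda>s\<in>{u}. X s \<omega>) \<in> ?B} = E"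
      by (auto simp: E_def space_PiM)
    ultimately show "AE \<omega>\<in>D in M. real_cond_exp M past (indicator E) \<omega> = Z \<omega>"
      using markov[unfolded markov_process_def Let_def, rule_format, of "{u}" t ?B] order
      by (auto simp: past_def present_def Z_def)
  qed auto
  finally have int_D: "(LINT \<omega>:D|M. indicator E \<omega>) = (LINT \<omega>:D|M. Z \<omega>)" .
  have int_C: "(LINT \<omega>:C|M. indicator E \<omega>) = (LINT \<omega>:C|M. Z \<omega>)"
    unfolding Z_def by (rule present.real_cond_exp_intA) (simp_all add: C E_int)
  have const: "Z \<omega> = Z \<omega>\<^sub>0" if "\<omega> \<in> C" for \<omega>
    by (rule generated_sigma_measurable_singleton[of Z M X t])
      (use that \<omega>\<^sub>0 in \<open>auto simp: C_def Z_def present_def\<close>)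
  have int_Z: "(LINT \<omega>:A|M. Z \<omega>) = Z \<omega>\<^sub>0 * prob A" if "A \<subseteq> C" "A \<in> sets M" for A
  proof -
    have "(LINT \<omega>:A|M. Z \<omega>) = (LINT \<omega>:A|M. Z \<omega>\<^sub>0)"
      by (rule set_lebesgue_integral_cong) (use that const in auto)
    then show ?thesis using that by (simp add: set_lebesgue_integral_def)
  qed
  have int_E: "(LINT \<omega>:A|M. indicator E \<omega>) = prob (A \<inter> E)" if "A \<in> sets M" for A
    using that by (simp add: set_lebesgue_integral_def indicator_inter_arith[symmetric])
  have "D \<subseteq> C" by (auto simp: C_def D_def)
  then have "prob (D \<inter> E) = Z \<omega>\<^sub>0 * prob D" "prob (C \<inter> E) = Z \<omega>\<^sub>0 * prob C"
    using int_C int_D by (simp_all add: int_Z int_E)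
  moreover have "D \<inter> E = {\<omega> \<in> space M. X r \<omega> = a \<and> X t \<omega> = b \<and> X u \<omega> = c}"
    "C \<inter> E = {\<omega> \<in> space M. X t \<omega> = b \<and> X u \<omega> = c}"
    by (auto simp: C_def D_def E_def)
  ultimately show ?thesis by (simp add: C_def D_def mult_ac)
qed

section \<open>Areas of the sets \<open>G\<close> and the consequence of the Markov property\<close>

lemma emeasure_G_Int_G:
  assumes "\<theta> > 0" "l > 0"
  shows "emeasure lborel (G \<theta> l s \<inter> G \<theta> l t) = ennreal (\<theta> * exp (- l * \<bar>of_int s - of_int t\<bar>))"
  using assms by (simp add: G_eq_hill hill_Int_hill emeasure_hill)

lemma measure_G_Int_G:
  assumes "\<theta> > 0" "l > 0"
  shows "measure lborel (G \<theta> l s \<inter> G \<theta> l t) = \<theta> * exp (- l * \<bar>of_int s - of_int t\<bar>)"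
  using emeasure_G_Int_G[OF assms, of s t] assms by (simp add: measure_def)

lemma measure_G: "\<theta> > 0 \<Longrightarrow> l > 0 \<Longrightarrow> measure lborel (G \<theta> l t) = \<theta>"
  using measure_G_Int_G[of \<theta> l t t] by simp

text \<open>The unsimplified \<open>1 * x\<close> here and \<open>0 + - 1 * x\<close> in
  \<open>G_reflect\<close> match the map in \<open>fdd_vimage_affine\<close> with
  \<open>c = 1\<close> and \<open>c = - 1\<close>.\<close>

lemma G_shift: "G \<theta> l (s + t) = (\<lambda>(x, y). (- of_int s + 1 * x, y)) -` G \<theta> l t"
  by (auto simp: G_def algebra_simps)

lemma G_reflect: "G \<theta> l (- t) = (\<lambda>(x, y). (0 + - 1 * x, y)) -` G \<theta> l t"
proof -
  have "\<bar>real_of_int (- t) - x\<bar> = \<bar>real_of_int t - (0 + - 1 * x)\<bar>" for x by simp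
  then show ?thesis unfolding G_def by auto
qed

context nat_random_measure
begin

lemma finite_area_G: "\<theta> > 0 \<Longrightarrow> l > 0 \<Longrightarrow> finite_area (G \<theta> l t)"
  using emeasure_G_Int_G[of \<theta> l t t] by (simp add: finite_area_def G_eq_hill)

lemma levy_eq_zero_if_markov:
  assumes \<theta>: "\<theta> > 0" and l: "l > 0" and markov: "markov_process M (random_measure_process N \<theta> l)"
    and k: "k \<ge> 2"
  shows "levy k = 0"
proof -
  define \<rho> where "\<rho> = exp (- l)"
  define A where "A = G \<theta> l 0"
  define B where "B = G \<theta> l (- 1)"
  define C where "C = G \<theta> l 1"
  have \<rho>: "0 < \<rho>" "\<rho> < 1" using l by (simp_all add: \<rho>_def)
  have fin: "finite_area A" "finite_area B" "finite_area C"
    using \<theta> l by (simp_all add: A_def B_def C_def finite_area_G)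
  then have fm: "A \<in> fmeasurable lborel" "B \<in> fmeasurable lborel" "C \<in> fmeasurable lborel"
    by (auto simp: finite_area_def fmeasurable_def)
  have area: "measure lborel A = \<theta>" "measure lborel B = \<theta>" "measure lborel C = \<theta>"
    using \<theta> l by (simp_all add: A_def B_def C_def measure_G)
  have "exp (- (l * 2)) = \<rho>\<^sup>2"
    by (simp add: \<rho>_def exp_double[symmetric])
  then have area_Int: "measure lborel (A \<inter> B) = \<theta> * \<rho>" "measure lborel (A \<inter> C) = \<theta> * \<rho>"
    "measure lborel (B \<inter> C) = \<theta> * \<rho>\<^sup>2"
    using \<theta> l by (simp_all add: A_def B_def C_def measure_G_Int_G \<rho>_def)
  \<comment> \<open>For every \<open>x\<close>, one of the points -1 and 1 is at least as far from
    \<open>x\<close> as 0 is, and the boundary curve falls with distance.\<close>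
  have sub: "B \<inter> C \<subseteq> A"
  proof -
    have mono: "y < \<theta> * l * exp (- 2 * l * \<bar>x\<bar>)"
      if "y < \<theta> * l * exp (- 2 * l * z)" "\<bar>x\<bar> \<le> z" for x y z
      by (rule less_le_trans[OF that(1)]) (use \<theta> l that(2) in simp)
    have "y < \<theta> * l * exp (- 2 * l * \<bar>x\<bar>)"
      if "y < \<theta> * l * exp (- 2 * l * \<bar>- 1 - x\<bar>)" "y < \<theta> * l * exp (- 2 * l * \<bar>1 - x\<bar>)" for x y
      using mono[OF that(1), of x] mono[OF that(2), of x] by linarith
    then show ?thesis by (auto simp: A_def B_def C_def G_def)
  qed
  have diff: "measure lborel (D - E) = measure lborel D - measure lborel (D \<inter> E)"
    if "D \<in> fmeasurable lborel" "E \<in> fmeasurable lborel" for D E :: "(real \<times> real) set"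
    using measure_Un2[OF that(2,1)] measure_Un3[OF that] by (simp add: Un_commute)
  have area_Un: "measure lborel (B \<union> C) = 2 * \<theta> - \<theta> * \<rho>\<^sup>2"
    using measure_Un3[OF fm(2,3)] by (simp add: area area_Int)
  have "A \<inter> (B \<union> C) = (A \<inter> B) \<union> (A \<inter> C)" "(A \<inter> B) \<inter> (A \<inter> C) = B \<inter> C" using sub by auto
  then have "measure lborel (A \<inter> (B \<union> C)) = 2 * (\<theta> * \<rho>) - \<theta> * \<rho>\<^sup>2"
    using measure_Un3[of "A \<inter> B" lborel "A \<inter> C"] fm by (simp add: area_Int fmeasurable.Int)
  then have area_mid: "measure lborel (A - (B \<union> C)) = \<theta> * (1 - \<rho>)\<^sup>2"
    using diff[of A "B \<union> C"] fm by (simp add: area fmeasurable.Un power2_eq_square algebra_simps)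
  have area_Diff: "measure lborel (A - B) = \<theta> * (1 - \<rho>)" "measure lborel (A - C) = \<theta> * (1 - \<rho>)"
    by (simp_all add: diff fm area area_Int right_diff_distrib)
  \<comment> \<open>The probability that \<open>B\<close> and \<open>C\<close> are both void. Only
    its positivity matters, since it cancels below.\<close>
  define K where "K = pmf (\<mu> (2 * \<theta> - \<theta> * \<rho>\<^sup>2)) 0"
  have eq: "K * (pmf (\<mu> (\<theta> * (1 - \<rho>)\<^sup>2)) n * pmf (\<mu> \<theta>) n) = (pmf (\<mu> \<theta>) 0 * pmf (\<mu> (\<theta> * (1 - \<rho>))) n)\<^sup>2"
    for n
  proof -
    let ?X = "random_measure_process N \<theta> l"
    have X: "?X (- 1) = (\<lambda>\<omega>. measure (N \<omega>) B)" "?X 0 = (\<lambda>\<omega>. measure (N \<omega>) A)" "?X 1 = (\<lambda>\<omega>. measure (N \<omega>) C)"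
      by (auto simp: random_measure_process_def A_def B_def C_def)
    have meas: "?X t \<in> borel_measurable M" for t
      using measurable_measure_N[OF finite_area_borel[OF finite_area_G[OF \<theta> l]], of t]
      by (simp add: random_measure_process_def[abs_def])
    have "prob {\<omega> \<in> space M. ?X (- 1) \<omega> = 0 \<and> ?X 0 \<omega> = real n \<and> ?X 1 \<omega> = 0} * prob {\<omega> \<in> space M. ?X 0 \<omega> = real n} =
        prob {\<omega> \<in> space M. ?X (- 1) \<omega> = 0 \<and> ?X 0 \<omega> = real n} * prob {\<omega> \<in> space M. ?X 0 \<omega> = real n \<and> ?X 1 \<omega> = 0}"
      by (rule markov_process_cond_indep[OF markov meas]) auto
    \<comment> \<open>The four probabilities are the void formula for the pairs
      \<open>(B, C)\<close>, \<open>({}, {})\<close>, \<open>(B, B)\<close> and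
      \<open>(C, C)\<close>, each with \<open>A\<close> as the counted set.\<close>
    then show ?thesis
      using prob_void_void_count[OF fin(2,3,1), of n] prob_void_void_count[OF finite_area_empty finite_area_empty fin(1), of n]
        prob_void_void_count[OF fin(2,2,1), of n] prob_void_void_count[OF fin(3,3,1), of n]
      by (simp add: X area_Un area_mid area area_Diff K_def pmf_at_zero conj_ac power2_eq_square mult_ac)
  qed
  have "0 \<le> 2 * \<theta> - \<theta> * \<rho>\<^sup>2" using area_Un measure_nonneg[of lborel "B \<union> C"] by simp
  then have K: "K > 0" unfolding K_def by (rule pmf_zero_pos)
  show ?thesis
  proof (rule levy_eq_zero_if_ratio[OF \<theta> _ _ k, of "1 - \<rho>"])
    fix n
    let ?x = "\<lambda>n. pmf (\<mu> (\<theta> * (1 - \<rho>)\<^sup>2)) n * pmf (\<mu> \<theta>) n" and ?y = "\<lambda>n. pmf (\<mu> (\<theta> * (1 - \<rho>))) n"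
    \<comment> \<open>Dividing the identity at \<open>n\<close> by the identity at 0 removes both
      \<open>K\<close> and \<open>pmf (\<mu> \<theta>) 0\<close>.\<close>
    have "?x n / ?x 0 = (K * ?x n) / (K * ?x 0)" using K by simp
    also have "\<dots> = (?y n / ?y 0)\<^sup>2"
      unfolding eq using pmf_zero_pos[of \<theta>] \<theta> by (simp add: power_mult_distrib power_divide)
    finally show "(pmf (\<mu> (\<theta> * (1 - \<rho>)\<^sup>2)) n / pmf (\<mu> (\<theta> * (1 - \<rho>)\<^sup>2)) 0) * (pmf (\<mu> \<theta>) n / pmf (\<mu> \<theta>) 0) =
        (?y n / ?y 0)\<^sup>2" by simp
  qed (use \<rho> in auto)
qed

end

theorem theorem3:
  fixes M :: "'w measure" and N :: "'w \<Rightarrow> (real \<times> real) measure"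
    and \<mu> :: "real \<Rightarrow> nat pmf" and \<theta> \<rho> l :: real
    and X :: "int \<Rightarrow> 'w \<Rightarrow> real"
  assumes "prob_space M"
    and "convolution_semigroup \<mu>"
    and "\<And>a. a > 0 \<Longrightarrow> measure_pmf.prob (\<mu> a) {1} > 0"
    and "independent_random_measure M \<mu> N"
    and "\<theta> > 0" and "0 < \<rho>" and "\<rho> < 1" and "l = - ln \<rho>"
    and "X = random_measure_process N \<theta> l"
  shows "infinitely_divisible_process M X \<and>
         stationary_process M X \<and>
         time_reversible_process M X \<and>
         nonneg_integer_valued M X \<and>
         (\<not> poisson_family \<mu> \<longrightarrow> \<not> markov_process M X)"
proof -
  interpret nat_random_measure M \<mu> N
    using assms(1-4)
    by (simp add: nat_random_measure_def nat_convolution_semigroup_def nat_random_measure_axioms_def)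
  have l: "l > 0" using assms(6-8) by simp
  have fin: "finite_area (G \<theta> l t)" for t using assms(5) l by (rule finite_area_G)
  have X: "X = (\<lambda>t \<omega>. measure (N \<omega>) (G \<theta> l t))"
    by (simp add: assms(9) random_measure_process_def fun_eq_iff)
  have stationary: "stationary_process M X"
    unfolding stationary_process_def X G_shift
  proof (intro allI impI)
    fix T :: "int set" and s :: int assume T: "finite T"
    show "fdd M (\<lambda>t \<omega>. measure (N \<omega>) (G \<theta> l t)) T =
        fdd M (\<lambda>t \<omega>. measure (N \<omega>) ((\<lambda>(x, y). (- of_int s + 1 * x, y)) -` G \<theta> l t)) T"
      by (rule fdd_vimage_affine[symmetric, OF T fin]) simp
  qed
  moreover have "time_reversible_process M X"
    unfolding time_reversible_process_def
  proof (intro conjI stationary, unfold X G_reflect, intro allI impI)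
    fix T :: "int set" assume T: "finite T"
    show "fdd M (\<lambda>t \<omega>. measure (N \<omega>) (G \<theta> l t)) T =
        fdd M (\<lambda>t \<omega>. measure (N \<omega>) ((\<lambda>(x, y). (0 + - 1 * x, y)) -` G \<theta> l t)) T"
      by (rule fdd_vimage_affine[symmetric, OF T fin]) simp
  qed
  moreover have "\<not> poisson_family \<mu> \<longrightarrow> \<not> markov_process M X"
    using poisson_family_if_levy levy_eq_zero_if_markov[OF assms(5) l] assms(9) by blast
  ultimately show ?thesis
    using infinitely_divisible_N[of "G \<theta> l"] nonneg_integer_valued_N[of "G \<theta> l"] fin by (simp add: X)
qed

end
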